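(* Let $S$ be the spline space of degree $p$ with associated $(p+1)$-basic knot vector $\Xi=\{\xi_1,\dots,\xi_{n+p+1}\}$. Let $\zeta_{j_0}$ be an interior breakpoint, let $i_0$ be the index such that $\zeta_{j_0}=\xi_{i_0}$ and $\xi_{i_0-1}\le\xi_{i_0}<\xi_{i_0+1}$, and let $\ell+1$ denote the multiplicity of $\xi_{i_0}$ in $\Xi$. If $s\in S$, then $$\mathbb{E}_{\Xi,j_0}(s)=C_{\rm loc}\,\big|\mathcal{J}_{\zeta_{j_0}}(D^{p-\ell}s)\big|,$$ where $\mathbb{E}_{\Xi,j_0}(s):=\min_{g\in\hat S}\|g-s\|_\Xi$ and $C_{\rm loc}$ is a positive constant, depending only on the knots $\Xi_{\rm loc}=\{\xi_{i_0-p-1},\dots,\xi_{i_0+p+1-\ell}\}$ (for the fixed degree $p$), given explicitly by $$C_{\rm loc}:=r_{p+2-\ell}\,\frac{\ell!}{p!}\prod_{k=i_0+1}^{i_0+p-\ell}(\xi_k-\xi_{i_0}),$$ with $r_{p+2-\ell}$ the constant defined in the context.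
   Context: Fix a polynomial degree $p\in\mathbb{N}$ (positive integer), breakpoints $a=\zeta_1<\zeta_2<\dots<\zeta_N=b$, and multiplicities $1\le m_j\le p+1$ for $j=2,\dots,N-1$. $S$ is the space of piecewise polynomial functions of degree $\le p$ on these breakpoints having $p-m_j$ continuous derivatives at $\zeta_j$ (no continuity required if $m_j=p+1$); $n:=\dim S=p+1+\sum_{j=2}^{N-1}m_j$. An associated $(p+1)$-basic knot vector is $\Xi=\{\xi_1,\dots,\xi_{n+p+1}\}$ with $\xi_1\le\dots\le\xi_{p+1}=\zeta_1$, followed by each interior breakpoint $\zeta_j$ repeated $m_j$ times in increasing order, followed by $\zeta_N=\xi_{n+1}\le\dots\le\xi_{n+p+1}$. $B_1,\dots,B_n$ is the B-spline basis of degree $p$ of $S$ associated with $\Xi$ (normalized to sum to one on $[a,b]$; $B_i$ is determined by $\xi_i,\dots,\xi_{i+p+1}$). The $\Xi$-norm of $s=\sum_{i=1}^n c_iB_i$ is $\|s\|_\Xi:=\big(\sum_{i=1}^n c_i^2\,\omega_i^2\big)^{1/2}$, where $\omega_i:=\big(\frac{\xi_{i+p+1}-\xi_i}{p+1}\big)^{1/2}$. For an interior breakpoint $\zeta_{j_0}$ ($2\le j_0\le N-1$), with $i_0$ and $\ell=m_{j_0}-1$ as in the claim, $\hat\Xi:=\Xi\setminus\{\xi_{i_0}\}$ (one occurrence removed), and $\hat S\subset S$ is the spline space of degree $p$ spanned by the B-splines associated with $\hat\Xi$. The constant $r_{p+2-\ell}$: for $j=1,\dots,p+2-\ell$ let $\alpha_j:=\frac{\xi_{i_0}-\xi_{i_0-p-2+j}}{\xi_{i_0-1+j}-\xi_{i_0-p-2+j}}$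 and $e_j:=\omega_{i_0-p-2+j}$; let $\mu_{j-1}:=\frac{1-\alpha_j}{\alpha_{j-1}}$ for $j=2,\dots,p+2-\ell$; let $\gamma_{\rm loc}:=\big(1+e_{p+2-\ell}^2\sum_{j=1}^{p+1-\ell}\frac{1}{e_j^2}\prod_{i=j}^{p+1-\ell}\mu_i^2\big)^{-1/2}$; then $r_{p+2-\ell}:=\gamma_{\rm loc}\,e_{p+2-\ell}$. The jump of a piecewise continuous function $f$ at $\xi$ is $\mathcal{J}_\xi(f):=\lim_{x\to\xi^+}f(x)-\lim_{x\to\xi^-}f(x)$. $D^{k}$ denotes the $k$-th derivative, taken piecewise between breakpoints ($D^0$ is the identity). *)

theory Defs
  imports "HOL-Analysis.Analysis" "HOL-Computational_Algebra.Polynomial"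
begin

text \<open>
  All sequences (breakpoints, multiplicities, knots) are functions on \<open>nat\<close> indexed from 1;
  only their values on the stated index ranges matter. Splines are functions
  \<open>real \<Rightarrow> real\<close> of which only the restriction to \<open>{\<zeta> 1..\<zeta> N}\<close> is used.
\<close>

definition breakpoint_data :: "nat \<Rightarrow> nat \<Rightarrow> (nat \<Rightarrow> real) \<Rightarrow> (nat \<Rightarrow> nat) \<Rightarrow> bool" where
  "breakpoint_data p N \<zeta> m \<longleftrightarrow>
     2 \<le> N \<and> strict_mono_on {1..N} \<zeta> \<and> (\<forall>j\<in>{2..<N}. 1 \<le> m j \<and> m j \<le> p + 1)"

definition spline_dim :: "nat \<Rightarrow> nat \<Rightarrow> (nat \<Rightarrow> nat) \<Rightarrow> nat" where
  "spline_dim p N m = p + 1 + (\<Sum>j\<in>{2..<N}. m j)"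

text \<open>
  Pieces are closed on the left and open on the right, except for the last one, which contains
  the right endpoint. This fixes the (otherwise irrelevant) values at points of discontinuity.
\<close>

definition piece :: "nat \<Rightarrow> (nat \<Rightarrow> real) \<Rightarrow> nat \<Rightarrow> real set" where
  "piece N \<zeta> j = (if j + 1 = N then {\<zeta> j..\<zeta> (j + 1)} else {\<zeta> j..<\<zeta> (j + 1)})"

text \<open>
  Smoothness of order \<open>p - m j\<close> at \<open>\<zeta> j\<close>: the derivatives of order \<open>0, \<dots>, p - m j\<close> are continuous
  there. The guard \<open>k + m j \<le> p\<close> makes the condition void for \<open>m j = p + 1\<close>.
\<close>

definition spline_space ::
  "nat \<Rightarrow> nat \<Rightarrow> (nat \<Rightarrow> real) \<Rightarrow> (nat \<Rightarrow> nat) \<Rightarrow> (real \<Rightarrow> real) set" where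
  "spline_space p N \<zeta> m =
     {s. (\<forall>j\<in>{1..<N}. \<exists>q::real poly. degree q \<le> p \<and> (\<forall>x\<in>piece N \<zeta> j. s x = poly q x)) \<and>
         (\<forall>j\<in>{2..<N}. \<forall>k. k + m j \<le> p \<longrightarrow> isCont ((deriv ^^ k) s) (\<zeta> j))}"

definition basic_knot_vector ::
  "nat \<Rightarrow> nat \<Rightarrow> (nat \<Rightarrow> real) \<Rightarrow> (nat \<Rightarrow> nat) \<Rightarrow> (nat \<Rightarrow> real) \<Rightarrow> bool" where
  "basic_knot_vector p N \<zeta> m \<xi> \<longleftrightarrow>
     (let n = spline_dim p N m in
        mono_on {1..n + p + 1} \<xi> \<and>
        \<xi> (p + 1) = \<zeta> 1 \<and>
        map \<xi> [p + 2..<n + 1] = concat (map (\<lambda>j. replicate (m j) (\<zeta> j)) [2..<N]) \<and>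
        \<xi> (n + 1) = \<zeta> N)"

text \<open>
  Cox--de Boor recursion, with the usual convention that terms with vanishing denominator are 0.
  The parameter \<open>b\<close> is the right endpoint of the interval on which the splines live: the
  B-splines are right-continuous to the left of \<open>b\<close> and left-continuous at \<open>b\<close>, so that they sum
  to one at \<open>b\<close> as well.
\<close>

fun bspline :: "real \<Rightarrow> (nat \<Rightarrow> real) \<Rightarrow> nat \<Rightarrow> nat \<Rightarrow> real \<Rightarrow> real" where
  "bspline b \<xi> 0 i x =
     (if x < b then of_bool (\<xi> i \<le> x \<and> x < \<xi> (i + 1)) else of_bool (\<xi> i < x \<and> x \<le> \<xi> (i + 1)))"
| "bspline b \<xi> (Suc d) i x =
     (x - \<xi> i) / (\<xi> (i + d + 1) - \<xi> i) * bspline b \<xi> d i x +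
     (\<xi> (i + d + 2) - x) / (\<xi> (i + d + 2) - \<xi> (i + 1)) * bspline b \<xi> d (i + 1) x"

text \<open>
  In the following, \<open>\<xi> 1, \<dots>, \<xi> (n + p + 1)\<close> is a knot vector with \<open>n\<close> B-splines of degree \<open>p\<close>,
  considered on the interval \<open>{\<xi> (p + 1)..\<xi> (n + 1)}\<close>.
\<close>

definition bspline_comb :: "nat \<Rightarrow> nat \<Rightarrow> (nat \<Rightarrow> real) \<Rightarrow> (nat \<Rightarrow> real) \<Rightarrow> real \<Rightarrow> real" where
  "bspline_comb p n \<xi> c x = (\<Sum>i=1..n. c i * bspline (\<xi> (n + 1)) \<xi> p i x)"

definition bspline_span :: "nat \<Rightarrow> nat \<Rightarrow> (nat \<Rightarrow> real) \<Rightarrow> (real \<Rightarrow> real) set" where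
  "bspline_span p n \<xi> = {g. \<exists>c. \<forall>x\<in>{\<xi> (p + 1)..\<xi> (n + 1)}. g x = bspline_comb p n \<xi> c x}"

definition bspline_coeffs :: "nat \<Rightarrow> nat \<Rightarrow> (nat \<Rightarrow> real) \<Rightarrow> (real \<Rightarrow> real) \<Rightarrow> nat \<Rightarrow> real" where
  "bspline_coeffs p n \<xi> s =
     (THE c. (\<forall>i. i \<notin> {1..n} \<longrightarrow> c i = 0) \<and>
             (\<forall>x\<in>{\<xi> (p + 1)..\<xi> (n + 1)}. s x = bspline_comb p n \<xi> c x))"

definition knot_weight :: "nat \<Rightarrow> (nat \<Rightarrow> real) \<Rightarrow> nat \<Rightarrow> real" where
  "knot_weight p \<xi> i = sqrt ((\<xi> (i + p + 1) - \<xi> i) / real (p + 1))"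

definition knot_norm :: "nat \<Rightarrow> nat \<Rightarrow> (nat \<Rightarrow> real) \<Rightarrow> (real \<Rightarrow> real) \<Rightarrow> real" where
  "knot_norm p n \<xi> s = sqrt (\<Sum>i=1..n. (bspline_coeffs p n \<xi> s i)\<^sup>2 * (knot_weight p \<xi> i)\<^sup>2)"

definition remove_knot :: "nat \<Rightarrow> (nat \<Rightarrow> real) \<Rightarrow> nat \<Rightarrow> real" where
  "remove_knot i0 \<xi> i = (if i < i0 then \<xi> i else \<xi> (i + 1))"

definition reduced_space :: "nat \<Rightarrow> nat \<Rightarrow> (nat \<Rightarrow> real) \<Rightarrow> nat \<Rightarrow> (real \<Rightarrow> real) set" where
  "reduced_space p n \<xi> i0 = bspline_span p (n - 1) (remove_knot i0 \<xi>)"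

text \<open>
  The minimum over \<open>reduced_space\<close>; \<open>LEAST\<close> is meaningful only if the minimum is attained.
\<close>

definition removal_error :: "nat \<Rightarrow> nat \<Rightarrow> (nat \<Rightarrow> real) \<Rightarrow> nat \<Rightarrow> (real \<Rightarrow> real) \<Rightarrow> real" where
  "removal_error p n \<xi> i0 s =
     (LEAST r. r \<in> (\<lambda>g. knot_norm p n \<xi> (\<lambda>x. g x - s x)) ` reduced_space p n \<xi> i0)"

definition jump :: "(real \<Rightarrow> real) \<Rightarrow> real \<Rightarrow> real" where
  "jump f x = Lim (at_right x) f - Lim (at_left x) f"

text \<open>
  Below, \<open>i0\<close> is the position of the removed knot and \<open>l + 1\<close> its multiplicity; always
  \<open>i0 \<ge> p + 2\<close>, \<open>l \<le> p\<close> and \<open>j \<ge> 1\<close>, so the natural-number subtractions are exact.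
\<close>

definition alpha :: "nat \<Rightarrow> (nat \<Rightarrow> real) \<Rightarrow> nat \<Rightarrow> nat \<Rightarrow> real" where
  "alpha p \<xi> i0 j =
     (\<xi> i0 - \<xi> (i0 + j - (p + 2))) / (\<xi> (i0 + j - 1) - \<xi> (i0 + j - (p + 2)))"

definition loc_weight :: "nat \<Rightarrow> (nat \<Rightarrow> real) \<Rightarrow> nat \<Rightarrow> nat \<Rightarrow> real" where
  "loc_weight p \<xi> i0 j = knot_weight p \<xi> (i0 + j - (p + 2))"

definition mu :: "nat \<Rightarrow> (nat \<Rightarrow> real) \<Rightarrow> nat \<Rightarrow> nat \<Rightarrow> real" where
  "mu p \<xi> i0 j = (1 - alpha p \<xi> i0 (j + 1)) / alpha p \<xi> i0 j"

definition gamma_loc :: "nat \<Rightarrow> nat \<Rightarrow> (nat \<Rightarrow> real) \<Rightarrow> nat \<Rightarrow> real" where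
  "gamma_loc p l \<xi> i0 =
     1 / sqrt (1 + (loc_weight p \<xi> i0 (p + 2 - l))\<^sup>2 *
       (\<Sum>j=1..p + 1 - l. 1 / (loc_weight p \<xi> i0 j)\<^sup>2 * (\<Prod>i=j..p + 1 - l. (mu p \<xi> i0 i)\<^sup>2)))"

definition C_loc :: "nat \<Rightarrow> nat \<Rightarrow> (nat \<Rightarrow> real) \<Rightarrow> nat \<Rightarrow> real" where
  "C_loc p l \<xi> i0 =
     gamma_loc p l \<xi> i0 * loc_weight p \<xi> i0 (p + 2 - l) *
     (fact l / fact p) * (\<Prod>k=i0 + 1..i0 + p - l. \<xi> k - \<xi> i0)"

definition local_knots :: "nat \<Rightarrow> nat \<Rightarrow> (nat \<Rightarrow> real) \<Rightarrow> nat \<Rightarrow> real list" where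
  "local_knots p l \<xi> i0 = map \<xi> [i0 - (p + 1)..<i0 + p + 2 - l]"

end

theory Submission
  imports Defs
begin

text \<open>
  The polynomials \<open>\<psi>\<^sub>i(y) = (y - \<xi>\<^sub>i\<^sub>+\<^sub>1) \<cdots> (y - \<xi>\<^sub>i\<^sub>+\<^sub>p)\<close> are dual to the B-splines under the de Boor--Fix
  pairing \<open>[f, q] = (\<Sum>v. (-1)^v f^(p-v) q^(v)) / p!\<close>, which does not depend on the point of
  evaluation: on every knot interval, \<open>[\<psi>\<^sub>i, B\<^sub>j] = \<delta>\<^sub>i\<^sub>j\<close> by Marsden's identity and the linear
  independence of the active \<open>\<psi>\<^sub>i\<close>. So the coefficients of a spline \<open>s\<close> are \<open>c\<^sub>i = [\<psi>\<^sub>i, q]\<close> for any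
  polynomial piece \<open>q\<close> of \<open>s\<close> on the support of \<open>B\<^sub>i\<close>.

  The recursion \<open>\<psi>\<^sub>i = A\<^sub>i \<phi>\<^sub>i + (1 - A\<^sub>i) \<phi>\<^sub>i\<^sub>-\<^sub>1\<close>, where the \<open>\<phi>\<^sub>i\<close> belong to the reduced knot vector, is knot
  insertion, and it yields a linear relation \<open>\<Sum>\<lambda>\<^sub>i \<psi>\<^sub>i = 0\<close> among consecutive \<open>\<psi>\<^sub>i\<close>. The reduced space is the
  hyperplane \<open>\<Sum>\<lambda>\<^sub>i c\<^sub>i = 0\<close>. For a spline, all but the last \<open>c\<^sub>i\<close> in this sum can be computed from the piece
  left of the removed knot, so the sum is \<open>[\<psi>, h]\<close> for the last \<open>\<psi>\<close> and the difference \<open>h\<close> of the two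
  adjacent pieces; only the term with the jump survives. The error is the distance to the hyperplane.
\<close>

section \<open>Higher derivatives of polynomials\<close>

lemma higher_pderiv_eq_0:
  assumes "degree (f :: real poly) < k"
  shows "(pderiv ^^ k) f = 0"
proof -
  obtain k' where k: "k = Suc k'" "degree f \<le> k'"
    using assms by (cases k) auto
  have "degree ((pderiv ^^ k') f) = 0"
    using k by (simp add: degree_higher_pderiv)
  then show ?thesis
    using k by (simp add: pderiv_eq_0_iff)
qed

text \<open>Leibniz rule: derivatives of order two and more of the linear factor vanish, so two
  terms remain. The order is \<open>Suc k\<close> to avoid a truncated subtraction.\<close>

lemma higher_pderiv_linear_mult:
  "(pderiv ^^ Suc k) ([:- a, 1:] * (f :: real poly)) =
     [:- a, 1:] * (pderiv ^^ Suc k) f + smult (of_nat (Suc k)) ((pderiv ^^ k) f)"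
proof (induction k)
  case 0
  show ?case
    unfolding funpow.simps o_apply id_apply pderiv_mult by (simp add: pderiv_pCons)
next
  case (Suc k)
  show ?case
    unfolding funpow.simps(2)[of "Suc k" pderiv] o_apply Suc pderiv_add pderiv_mult pderiv_smult
    by (simp only: of_nat_Suc[of "Suc k"] smult_add_left) (simp add: pderiv_pCons)
qed

text \<open>At \<open>a\<close> the first Leibniz term vanishes, so each differentiation strips one
  linear factor and leaves its order as a scalar.\<close>

lemma poly_higher_pderiv_linear_power_mult:
  assumes "k \<le> m"
  shows "poly ((pderiv ^^ k) ([:- a, 1:] ^ m * (f :: real poly))) a =
    (if k = m then fact m * poly f a else 0)"
  using assms
proof (induction m arbitrary: k)
  case 0
  then show ?case by simp
next
  case (Suc m)
  show ?case
  proof (cases k)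
    case 0
    then show ?thesis by simp
  next
    case (Suc k')
    have "poly ((pderiv ^^ Suc k') ([:- a, 1:] * ([:- a, 1:] ^ m * f))) a =
        real (Suc k') * poly ((pderiv ^^ k') ([:- a, 1:] ^ m * f)) a"
      unfolding higher_pderiv_linear_mult by simp
    moreover have "[:- a, 1:] * ([:- a, 1:] ^ m * f) = [:- a, 1:] ^ Suc m * f"
      by (simp only: power_Suc mult.assoc)
    ultimately show ?thesis
      using Suc Suc.IH[of k'] Suc.prems by simp
  qed
qed

section \<open>The de Boor--Fix pairing\<close>

definition pairing :: "nat \<Rightarrow> real poly \<Rightarrow> real poly \<Rightarrow> real \<Rightarrow> real" where
  "pairing p f q t =
     (\<Sum>v\<le>p. (- 1) ^ v * poly ((pderiv ^^ (p - v)) f) t * poly ((pderiv ^^ v) q) t) / fact p"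

lemma pairing_add_left: "pairing p (f + g) q t = pairing p f q t + pairing p g q t"
  by (simp add: pairing_def higher_pderiv_add algebra_simps sum.distrib add_divide_distrib)

lemma pairing_add_right: "pairing p f (q + r) t = pairing p f q t + pairing p f r t"
  by (simp add: pairing_def higher_pderiv_add algebra_simps sum.distrib add_divide_distrib)

lemma pairing_smult_left: "pairing p (smult c f) q t = c * pairing p f q t"
  by (simp add: pairing_def higher_pderiv_smult sum_distrib_left algebra_simps)

lemma pairing_smult_right: "pairing p f (smult c q) t = c * pairing p f q t"
  by (simp add: pairing_def higher_pderiv_smult sum_distrib_left algebra_simps)

lemma pairing_0_left: "pairing p 0 q t = 0"
  using pairing_smult_left[of p 0 0 q t] by simp

lemma pairing_0_right: "pairing p f 0 t = 0"
  using pairing_smult_right[of p f 0 0 t] by simp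

lemma pairing_sum_left: "pairing p (sum F I) q t = (\<Sum>i\<in>I. pairing p (F i) q t)"
  by (induction I rule: infinite_finite_induct) (simp_all add: pairing_0_left pairing_add_left)

lemma pairing_sum_right: "pairing p f (sum F I) t = (\<Sum>i\<in>I. pairing p f (F i) t)"
  by (induction I rule: infinite_finite_induct) (simp_all add: pairing_0_right pairing_add_right)

text \<open>The derivative with respect to the base point telescopes.\<close>

lemma pairing_base_point:
  assumes "degree f \<le> p" "degree q \<le> p"
  shows "pairing p f q t = pairing p f q u"
proof -
  define P where "P = (\<Sum>v\<le>p. smult ((- 1) ^ v) ((pderiv ^^ (p - v)) f * (pderiv ^^ v) q))"
  define T where "T v = smult ((- 1) ^ v) ((pderiv ^^ (Suc p - v)) f * (pderiv ^^ v) q)" for v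
  have "pderiv P = (\<Sum>v\<le>p. T v - T (Suc v))"
    unfolding P_def T_def higher_pderiv_sum[of 1, simplified]
    by (intro sum.cong refl)
       (simp add: pderiv_smult pderiv_mult Suc_diff_le smult_add_right[symmetric] algebra_simps)
  also have "\<dots> = T 0 - T (Suc p)"
    by (rule sum_telescope)
  also have "\<dots> = 0"
    using assms higher_pderiv_eq_0[of f "Suc p"] higher_pderiv_eq_0[of q "Suc p"]
    by (simp add: T_def del: funpow.simps)
  finally have "degree P = 0"
    by (simp add: pderiv_eq_0_iff)
  then obtain c where "P = [:c:]"
    by (rule degree_eq_zeroE)
  moreover have "pairing p f q x = poly P x / fact p" for x
    by (simp add: pairing_def P_def poly_sum mult.assoc)
  ultimately show ?thesis
    by simp
qed

lemma poly_higher_pderiv_linear_power: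
  assumes "k \<le> p"
  shows "poly ((pderiv ^^ k) ([:- a, 1:] ^ p)) a = (if k = p then fact p else (0::real))"
  using poly_higher_pderiv_linear_power_mult[OF assms, of a 1] by simp

lemma degree_linear_power: "degree ([:- a, 1:] ^ p :: real poly) = p"
  by (simp add: degree_power_eq)

text \<open>With the base point moved to \<open>x\<close>, only the derivative of order
  \<open>p\<close> of the power survives, that is, the term \<open>v = 0\<close>. Pairing with the
  power is thus point evaluation.\<close>

lemma pairing_linear_power_left:
  assumes "degree q \<le> p"
  shows "pairing p ([:- x, 1:] ^ p) q t = poly q x"
proof -
  have "pairing p ([:- x, 1:] ^ p) q t = pairing p ([:- x, 1:] ^ p) q x"
    using assms by (intro pairing_base_point) (simp_all add: degree_linear_power)
  also have "\<dots> = (\<Sum>v\<le>p. if v = 0 then fact p * poly q x else 0) / fact p"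
    unfolding pairing_def
    by (intro arg_cong2[of _ _ _ _ "(/)"] sum.cong refl) (auto simp: poly_higher_pderiv_linear_power)
  finally show ?thesis
    by simp
qed

text \<open>The mirror image: at the base point \<open>y\<close> only \<open>v = p\<close> survives,
  and its sign cancels the one from rewriting the power of \<open>y - x\<close> in terms of
  \<open>x - y\<close>.\<close>

lemma pairing_linear_power_right:
  assumes "degree f \<le> p"
  shows "pairing p f ([:y, - 1:] ^ p) t = poly f y"
proof -
  have "[:y, - 1:] ^ p = (- [:- y, 1:]) ^ p"
    by simp
  also have "\<dots> = smult ((- 1) ^ p) ([:- y, 1:] ^ p)"
    by (simp add: smult_power[symmetric] flip: smult_minus_left)
  finally have "pairing p f ([:y, - 1:] ^ p) t = (- 1) ^ p * pairing p f ([:- y, 1:] ^ p) t"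
    by (simp add: pairing_smult_right)
  also have "pairing p f ([:- y, 1:] ^ p) t = pairing p f ([:- y, 1:] ^ p) y"
    using assms by (intro pairing_base_point) (simp_all add: degree_linear_power)
  also have "\<dots> = (\<Sum>v\<le>p. if v = p then (- 1) ^ p * fact p * poly f y else 0) / fact p"
    unfolding pairing_def
    by (intro arg_cong2[of _ _ _ _ "(/)"] sum.cong refl) (auto simp: poly_higher_pderiv_linear_power)
  finally show ?thesis
    by (simp flip: power_mult_distrib)
qed

section \<open>Dual polynomials\<close>

definition dual_poly :: "(nat \<Rightarrow> real) \<Rightarrow> nat \<Rightarrow> nat \<Rightarrow> real poly" where
  "dual_poly \<xi> d i = (\<Prod>k=i + 1..i + d. [:- \<xi> k, 1:])"

lemma degree_dual_poly: "degree (dual_poly \<xi> d i) = d"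
  by (simp add: dual_poly_def degree_prod_sum_eq)

lemma dual_poly_0 [simp]: "dual_poly \<xi> 0 i = 1"
  by (simp add: dual_poly_def)

lemma dual_poly_Suc: "dual_poly \<xi> (Suc d) i = dual_poly \<xi> d i * [:- \<xi> (i + d + 1), 1:]"
  by (simp add: dual_poly_def)

lemma dual_poly_Suc': "dual_poly \<xi> (Suc d) i = [:- \<xi> (i + 1), 1:] * dual_poly \<xi> d (i + 1)"
proof -
  have "{i + 1..i + Suc d} = insert (i + 1) {i + 1 + 1..i + 1 + d}"
    by auto
  then show ?thesis
    by (simp add: dual_poly_def)
qed

text \<open>Splitting off the zero at knot \<open>r\<close> leaves consecutive knots of the
  shortened vector. This drives both the independence proof and knot insertion.\<close>

lemma dual_poly_remove_knot:
  assumes "i < r" "r \<le> i + Suc d"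
  shows "dual_poly \<xi> (Suc d) i = [:- \<xi> r, 1:] * dual_poly (remove_knot r \<xi>) d i"
  using assms
proof (induction d)
  case 0
  then have "r = Suc i" by simp
  then show ?case by (simp add: dual_poly_def)
next
  case (Suc d)
  show ?case
  proof (cases "r = i + Suc (Suc d)")
    case True
    have "dual_poly (remove_knot r \<xi>) (Suc d) i = dual_poly \<xi> (Suc d) i"
      unfolding dual_poly_def using True by (intro prod.cong refl) (simp add: remove_knot_def)
    then show ?thesis
      using True dual_poly_Suc[of \<xi> "Suc d" i] by (simp add: mult.commute)
  next
    case False
    then have r: "r \<le> i + Suc d"
      using Suc.prems by simp
    have "remove_knot r \<xi> (i + d + 1) = \<xi> (i + Suc d + 1)"
      using r by (simp add: remove_knot_def)
    then show ?thesis
      using Suc.IH[OF Suc.prems(1) r] dual_poly_Suc[of \<xi> "Suc d" i]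
        dual_poly_Suc[of "remove_knot r \<xi>" d i] by (simp only: mult.assoc)
  qed
qed

text \<open>At \<open>\<xi> \<mu>\<close> every polynomial in the sum vanishes except the last,
  whose zeros lie among the knots after \<open>\<mu>\<close>. So its coefficient is 0; dividing the
  rest by the common linear factor gives the same situation with knot \<open>\<mu>\<close> removed
  and degree one less.\<close>

lemma dual_poly_independent:
  assumes "d \<le> \<mu>" "\<And>k k'. k \<in> {\<mu> - d + 1..\<mu>} \<Longrightarrow> k' \<in> {\<mu> + 1..\<mu> + d} \<Longrightarrow> \<xi> k \<noteq> \<xi> k'"
    and "(\<Sum>i=\<mu> - d..\<mu>. smult (a i) (dual_poly \<xi> d i)) = 0"
    and "i \<in> {\<mu> - d..\<mu>}"
  shows "a i = 0"
  using assms
proof (induction d arbitrary: \<mu> \<xi> i)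
  case 0
  then show ?case by (simp flip: one_pCons)
next
  case (Suc d)
  define \<eta> where "\<eta> = remove_knot \<mu> \<xi>"
  have range: "{\<mu> - Suc d..\<mu>} = insert \<mu> {\<mu> - 1 - d..\<mu> - 1}"
    using Suc.prems(1) by auto
  have factor: "dual_poly \<xi> (Suc d) k = [:- \<xi> \<mu>, 1:] * dual_poly \<eta> d k" if "k \<in> {\<mu> - 1 - d..\<mu> - 1}" for k
    unfolding \<eta>_def using that Suc.prems(1) by (intro dual_poly_remove_knot) auto
  have "(\<Sum>k\<in>{\<mu> - 1 - d..\<mu> - 1}. smult (a k) (dual_poly \<xi> (Suc d) k)) =
      [:- \<xi> \<mu>, 1:] * (\<Sum>k=\<mu> - 1 - d..\<mu> - 1. smult (a k) (dual_poly \<eta> d k))"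
    unfolding sum_distrib_left by (intro sum.cong refl) (simp only: factor mult_smult_right)
  moreover have "\<mu> \<notin> {\<mu> - 1 - d..\<mu> - 1}"
    using Suc.prems(1) by auto
  ultimately have eq: "smult (a \<mu>) (dual_poly \<xi> (Suc d) \<mu>) +
      [:- \<xi> \<mu>, 1:] * (\<Sum>k=\<mu> - 1 - d..\<mu> - 1. smult (a k) (dual_poly \<eta> d k)) = 0"
    using Suc.prems(3) unfolding range by simp
  have "poly (dual_poly \<xi> (Suc d) \<mu>) (\<xi> \<mu>) \<noteq> 0"
    using Suc.prems(1,2) by (auto simp: dual_poly_def poly_prod simp del: prod.cl_ivl_Suc)
  moreover have "a \<mu> * poly (dual_poly \<xi> (Suc d) \<mu>) (\<xi> \<mu>) = 0"
    using arg_cong[OF eq, of "\<lambda>q. poly q (\<xi> \<mu>)"] by simp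
  ultimately have a0: "a \<mu> = 0"
    by simp
  have "(\<Sum>k=\<mu> - 1 - d..\<mu> - 1. smult (a k) (dual_poly \<eta> d k)) = 0"
    using eq unfolding a0 by (simp del: mult_pCons_left)
  moreover have "\<eta> k \<noteq> \<eta> k'" if "k \<in> {\<mu> - 1 - d + 1..\<mu> - 1}" "k' \<in> {\<mu> - 1 + 1..\<mu> - 1 + d}" for k k'
  proof -
    have "k' + 1 \<le> \<mu> + Suc d"
      using that Suc.prems(1) by auto
    then show ?thesis
      using Suc.prems(2)[of k "k' + 1"] Suc.prems(1) that by (auto simp: \<eta>_def remove_knot_def)
  qed
  ultimately have "a k = 0" if "k \<in> {\<mu> - 1 - d..\<mu> - 1}" for k
    using Suc.IH[of "\<mu> - 1" \<eta> k] Suc.prems(1) that by (simp add: le_diff_conv)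
  then show ?case
    using a0 Suc.prems(4) unfolding range by auto
qed

section \<open>B-splines on one knot interval\<close>

text \<open>The polynomial that agrees with the B-spline on knot interval \<open>\<mu>\<close>: the
  Cox--de Boor recursion started from a Kronecker delta instead of an indicator function.\<close>

fun bspline_poly :: "(nat \<Rightarrow> real) \<Rightarrow> nat \<Rightarrow> nat \<Rightarrow> nat \<Rightarrow> real poly" where
  "bspline_poly \<xi> \<mu> 0 i = (if i = \<mu> then 1 else 0)"
| "bspline_poly \<xi> \<mu> (Suc d) i =
     smult (1 / (\<xi> (i + d + 1) - \<xi> i)) ([:- \<xi> i, 1:] * bspline_poly \<xi> \<mu> d i) +
     smult (1 / (\<xi> (i + d + 2) - \<xi> (i + 1))) ([:\<xi> (i + d + 2), - 1:] * bspline_poly \<xi> \<mu> d (i + 1))"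

text \<open>The last nontrivial interval is closed at \<open>b\<close>, matching the convention of
  \<open>bspline\<close> at the right endpoint.\<close>

definition knot_interval :: "real \<Rightarrow> (nat \<Rightarrow> real) \<Rightarrow> nat \<Rightarrow> real set" where
  "knot_interval b \<xi> \<mu> = (if \<xi> (\<mu> + 1) < b then {\<xi> \<mu>..<\<xi> (\<mu> + 1)} else {\<xi> \<mu>..b})"

text \<open>Both sides obey the same recursion, so only degree 0 needs the ordering of the
  knots.\<close>

lemma bspline_eq_bspline_poly:
  assumes "mono_on {1..M} \<xi>" "1 \<le> i" "i + d + 1 \<le> M" "1 \<le> \<mu>" "\<mu> + 1 \<le> M"
    and "\<xi> \<mu> < \<xi> (\<mu> + 1)" "\<xi> (\<mu> + 1) \<le> b" "x \<in> knot_interval b \<xi> \<mu>"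
  shows "bspline b \<xi> d i x = poly (bspline_poly \<xi> \<mu> d i) x"
  using assms(2,3)
proof (induction d arbitrary: i)
  case 0
  have le: "\<xi> j \<le> \<xi> k" if "1 \<le> j" "j \<le> k" "k \<le> M" for j k
    using that by (intro mono_onD[OF assms(1)]) auto
  consider "i < \<mu>" | "i = \<mu>" | "\<mu> < i"
    by linarith
  then show ?case
  proof cases
    case 1
    then have "\<xi> (i + 1) \<le> \<xi> \<mu>"
      using assms 0 by (intro le) auto
    then show ?thesis
      using 1 assms(6-8) by (auto simp: knot_interval_def split: if_splits)
  next
    case 2
    then show ?thesis
      using assms(6-8) by (auto simp: knot_interval_def split: if_splits)
  next
    case 3
    then have "\<xi> (\<mu> + 1) \<le> \<xi> i"
      using assms 0 by (intro le) auto
    then show ?thesis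
      using 3 assms(6-8) by (auto simp: knot_interval_def split: if_splits)
  qed
next
  case (Suc d)
  then show ?case
    unfolding bspline_poly.simps bspline.simps by (simp del: mult_pCons_left)
qed

lemma bspline_poly_eq_0:
  assumes "i + d < \<mu> \<or> \<mu> < i"
  shows "bspline_poly \<xi> \<mu> d i = 0"
  using assms by (induction d arbitrary: i) auto

lemma degree_bspline_poly: "degree (bspline_poly \<xi> \<mu> d i) \<le> d"
proof (induction d arbitrary: i)
  case (Suc d)
  have *: "degree ([:a, b:] * bspline_poly \<xi> \<mu> d i) \<le> Suc d" for a b i
    using degree_mult_le[of "[:a, b:]" "bspline_poly \<xi> \<mu> d i"] Suc[of i]
    by (simp add: degree_pCons_eq_if split: if_splits)
  show ?case
    unfolding bspline_poly.simps
    by (intro degree_add_le order.trans[OF degree_smult_le] *)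
qed simp

text \<open>Marsden's identity, by induction on the degree: after the recursion is inserted and the
  sum is regrouped by B-splines of degree \<open>d\<close>, each of them carries
  \<open>y - x\<close> times its own dual polynomial.\<close>

lemma marsden:
  assumes "mono_on {\<mu> - d + 1..\<mu> + d} \<xi>" "d \<le> \<mu>" "\<xi> \<mu> < \<xi> (\<mu> + 1)"
  shows "(\<Sum>i=\<mu> - d..\<mu>. poly (dual_poly \<xi> d i) y * poly (bspline_poly \<xi> \<mu> d i) x) = (y - x) ^ d"
  using assms(1,2)
proof (induction d)
  case 0
  then show ?case by simp
next
  case (Suc d)
  define L where "L i = (x - \<xi> i) / (\<xi> (i + d + 1) - \<xi> i)" for i
  define R where "R i = (\<xi> (i + d + 1) - x) / (\<xi> (i + d + 1) - \<xi> i)" for i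
  define \<Psi> where "\<Psi> i = poly (dual_poly \<xi> (Suc d) i) y" for i
  define b where "b i = poly (bspline_poly \<xi> \<mu> d i) x" for i
  have rec: "poly (bspline_poly \<xi> \<mu> (Suc d) i) x = L i * b i + R (i + 1) * b (i + 1)" for i
    unfolding bspline_poly.simps L_def R_def b_def by (simp add: left_diff_distrib[of _ _ "poly _ _"])
  \<comment> \<open>The two dual polynomials differ in one linear factor. \<open>L\<close> and
    \<open>R\<close> are the weights interpolating between the two end knots, so they turn these
    factors into \<open>y - x\<close>.\<close>
  have bracket: "\<Psi> (i + 1) * L (i + 1) + \<Psi> i * R (i + 1) = poly (dual_poly \<xi> d (i + 1)) y * (y - x)"
    if "i \<in> {\<mu> - Suc d..\<mu> - 1}" for i
  proof -
    have "\<xi> (i + 1) \<le> \<xi> \<mu>" "\<xi> (\<mu> + 1) \<le> \<xi> (i + 1 + d + 1)"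
      using that Suc.prems by (auto intro!: mono_onD[OF Suc.prems(1)])
    then have "\<xi> (i + 1 + d + 1) - \<xi> (i + 1) \<noteq> 0"
      using assms(3) by linarith
    moreover have "\<Psi> (i + 1) = poly (dual_poly \<xi> d (i + 1)) y * (y - \<xi> (i + 1 + d + 1))"
      unfolding \<Psi>_def by (subst dual_poly_Suc) (simp add: algebra_simps)
    moreover have "\<Psi> i = poly (dual_poly \<xi> d (i + 1)) y * (y - \<xi> (i + 1))"
      unfolding \<Psi>_def by (subst dual_poly_Suc') (simp add: algebra_simps)
    ultimately show ?thesis
      unfolding L_def R_def by (simp only: times_divide_eq_right add_divide_distrib[symmetric])
        (simp add: field_simps)
  qed
  \<comment> \<open>The boundary terms of the index shift vanish: these two B-splines of degree
    \<open>d\<close> are inactive on interval \<open>\<mu>\<close>.\<close>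
  have b0: "b (\<mu> - Suc d) = 0" "b (\<mu> + 1) = 0"
    using Suc.prems(2) by (simp_all add: b_def bspline_poly_eq_0)
  have range: "{\<mu> - Suc d..\<mu>} = insert (\<mu> - Suc d) (Suc ` {\<mu> - Suc d..\<mu> - 1})"
    "{\<mu> - Suc d..\<mu>} = insert \<mu> {\<mu> - Suc d..\<mu> - 1}"
    using Suc.prems(2) by (auto simp: image_iff Suc_le_eq intro!: bexI[of _ "_ - 1"])
  have "(\<Sum>i=\<mu> - Suc d..\<mu>. \<Psi> i * poly (bspline_poly \<xi> \<mu> (Suc d) i) x) =
      (\<Sum>i=\<mu> - Suc d..\<mu>. \<Psi> i * L i * b i) + (\<Sum>i=\<mu> - Suc d..\<mu>. \<Psi> i * R (i + 1) * b (i + 1))"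
    unfolding rec by (simp add: algebra_simps sum.distrib)
  also have "(\<Sum>i=\<mu> - Suc d..\<mu>. \<Psi> i * L i * b i) =
      (\<Sum>i=\<mu> - Suc d..\<mu> - 1. \<Psi> (i + 1) * L (i + 1) * b (i + 1))"
    unfolding range(1)
    by (subst sum.insert) (auto simp: b0 sum.reindex simp del: image_Suc_atLeastAtMost)
  also have "(\<Sum>i=\<mu> - Suc d..\<mu>. \<Psi> i * R (i + 1) * b (i + 1)) =
      (\<Sum>i=\<mu> - Suc d..\<mu> - 1. \<Psi> i * R (i + 1) * b (i + 1))"
    using Suc.prems(2) b0(2) by (subst range(2), subst sum.insert) auto
  also have "(\<Sum>i=\<mu> - Suc d..\<mu> - 1. \<Psi> (i + 1) * L (i + 1) * b (i + 1)) +
      (\<Sum>i=\<mu> - Suc d..\<mu> - 1. \<Psi> i * R (i + 1) * b (i + 1)) =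
      (\<Sum>i=\<mu> - Suc d..\<mu> - 1. (\<Psi> (i + 1) * L (i + 1) + \<Psi> i * R (i + 1)) * b (i + 1))"
    by (simp add: algebra_simps sum.distrib)
  also have "\<dots> = (\<Sum>i=\<mu> - Suc d..\<mu> - 1. poly (dual_poly \<xi> d (i + 1)) y * (y - x) * b (i + 1))"
    by (intro sum.cong refl) (simp only: bracket)
  also have "\<dots> = (y - x) * (\<Sum>i\<in>Suc ` {\<mu> - Suc d..\<mu> - 1}. poly (dual_poly \<xi> d i) y * b i)"
    by (subst sum.reindex) (simp_all add: sum_distrib_left algebra_simps)
  also have "Suc ` {\<mu> - Suc d..\<mu> - 1} = {\<mu> - d..\<mu>}"
    using Suc.prems(2) by (auto simp: image_iff Suc_le_eq intro!: bexI[of _ "_ - 1"])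
  also have "(\<Sum>i=\<mu> - d..\<mu>. poly (dual_poly \<xi> d i) y * b i) = (y - x) ^ d"
    unfolding b_def using Suc.prems by (intro Suc.IH mono_on_subset[OF Suc.prems(1)]) auto
  finally show ?case
    by (simp add: \<Psi>_def)
qed

text \<open>One nontrivial knot interval. The range of \<open>mono\<close> consists of the knots
  that occur in the \<open>p + 1\<close> active dual polynomials.\<close>

locale knot_piece =
  fixes p \<mu> :: nat and \<xi> :: "nat \<Rightarrow> real"
  assumes mono: "mono_on {\<mu> - p + 1..\<mu> + p} \<xi>"
    and p_le: "p \<le> \<mu>"
    and less: "\<xi> \<mu> < \<xi> (\<mu> + 1)"
begin

text \<open>Marsden's identity as an equality of polynomials in \<open>y\<close>; the next lemma
  reads it in \<open>x\<close>. These forms fit the two slots of the pairing.\<close>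

lemma linear_power_eq_sum_dual_poly:
  "[:- x, 1:] ^ p = (\<Sum>i=\<mu> - p..\<mu>. smult (poly (bspline_poly \<xi> \<mu> p i) x) (dual_poly \<xi> p i))"
  using marsden[OF mono p_le less]
  by (simp add: fun_eq_iff poly_sum poly_power mult.commute flip: poly_eq_poly_eq_iff)

lemma linear_power_eq_sum_bspline_poly:
  "[:y, - 1:] ^ p = (\<Sum>i=\<mu> - p..\<mu>. smult (poly (dual_poly \<xi> p i) y) (bspline_poly \<xi> \<mu> p i))"
  using marsden[OF mono p_le less]
  by (simp add: fun_eq_iff poly_sum poly_power mult.commute flip: poly_eq_poly_eq_iff)

lemma reproduction:
  assumes "degree q \<le> p"
  shows "poly q x = (\<Sum>i=\<mu> - p..\<mu>. pairing p (dual_poly \<xi> p i) q t * poly (bspline_poly \<xi> \<mu> p i) x)"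
proof -
  have "poly q x = pairing p ([:- x, 1:] ^ p) q t"
    using assms by (simp add: pairing_linear_power_left)
  then show ?thesis
    unfolding linear_power_eq_sum_dual_poly pairing_sum_left pairing_smult_left
    by (simp add: mult.commute)
qed

text \<open>Pairing the dual polynomial \<open>i\<close> with the expansion of the power of
  \<open>y - x\<close> gives that dual polynomial at \<open>y\<close>, now expanded in all active
  ones. By independence the coefficients are Kronecker deltas.\<close>

lemma biorthogonal:
  assumes "i \<in> {\<mu> - p..\<mu>}" "j \<in> {\<mu> - p..\<mu>}"
  shows "pairing p (dual_poly \<xi> p i) (bspline_poly \<xi> \<mu> p j) t = of_bool (i = j)"
proof -
  define B where "B k = pairing p (dual_poly \<xi> p i) (bspline_poly \<xi> \<mu> p k) t" for k
  have "poly (dual_poly \<xi> p i) y = (\<Sum>k=\<mu> - p..\<mu>. B k * poly (dual_poly \<xi> p k) y)" for y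
  proof -
    have "poly (dual_poly \<xi> p i) y = pairing p (dual_poly \<xi> p i) ([:y, - 1:] ^ p) t"
      by (simp add: pairing_linear_power_right degree_dual_poly)
    then show ?thesis
      unfolding linear_power_eq_sum_bspline_poly pairing_sum_right pairing_smult_right B_def
      by (simp add: mult.commute)
  qed
  moreover have "(\<Sum>k=\<mu> - p..\<mu>. of_bool (i = k) * poly (dual_poly \<xi> p k) y) = poly (dual_poly \<xi> p i) y" for y
    using assms(1) by (subst sum.remove[of _ i]) (auto intro!: sum.neutral)
  ultimately have "(\<Sum>k=\<mu> - p..\<mu>. B k * poly (dual_poly \<xi> p k) y) =
      (\<Sum>k=\<mu> - p..\<mu>. of_bool (i = k) * poly (dual_poly \<xi> p k) y)" for y
    by simp
  then have "(\<Sum>k=\<mu> - p..\<mu>. smult (B k - of_bool (i = k)) (dual_poly \<xi> p k)) = 0"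
    by (simp del: of_bool_eq_iff sum_of_bool_mult_eq add: fun_eq_iff poly_sum left_diff_distrib sum_subtractf flip: poly_eq_poly_eq_iff)
  moreover have "\<xi> k \<noteq> \<xi> k'" if "k \<in> {\<mu> - p + 1..\<mu>}" "k' \<in> {\<mu> + 1..\<mu> + p}" for k k'
  proof -
    have "\<xi> k \<le> \<xi> \<mu>" "\<xi> (\<mu> + 1) \<le> \<xi> k'"
      using that by (auto intro!: mono_onD[OF mono])
    then show ?thesis
      using less by linarith
  qed
  ultimately have "B j - of_bool (i = j) = 0"
    using dual_poly_independent[of p \<mu> \<xi> "\<lambda>k. B k - of_bool (i = k)" j] p_le assms(2) by blast
  then show ?thesis
    by (simp add: B_def)
qed

lemma pairing_bspline_sum:
  assumes "i \<in> {\<mu> - p..\<mu>}"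
  shows "pairing p (dual_poly \<xi> p i) (\<Sum>j=\<mu> - p..\<mu>. smult (c j) (bspline_poly \<xi> \<mu> p j)) t = c i"
proof -
  have "pairing p (dual_poly \<xi> p i) (\<Sum>j=\<mu> - p..\<mu>. smult (c j) (bspline_poly \<xi> \<mu> p j)) t =
      (\<Sum>j=\<mu> - p..\<mu>. c j * of_bool (i = j))"
    unfolding pairing_sum_right pairing_smult_right
    by (intro sum.cong refl) (simp only: biorthogonal[OF assms])
  also have "\<dots> = c i"
    using assms by (subst sum.remove[of _ i]) (auto intro!: sum.neutral)
  finally show ?thesis .
qed

end

section \<open>Knot vectors\<close>

locale knot_vector =
  fixes p n :: nat and \<xi> :: "nat \<Rightarrow> real"
  assumes knots_mono: "mono_on {1..n + p + 1} \<xi>"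
    and ends: "\<xi> (p + 1) < \<xi> (n + 1)"
begin

lemma knots_le: "1 \<le> i \<Longrightarrow> i \<le> j \<Longrightarrow> j \<le> n + p + 1 \<Longrightarrow> \<xi> i \<le> \<xi> j"
  by (rule mono_onD[OF knots_mono]) auto

lemma knot_piece:
  assumes "\<mu> \<in> {p + 1..n}" "\<xi> \<mu> < \<xi> (\<mu> + 1)"
  shows "knot_piece p \<mu> \<xi>"
  using assms by unfold_locales (auto intro!: mono_onI knots_le)

lemma ex_knot_interval:
  assumes "x \<in> {\<xi> (p + 1)..\<xi> (n + 1)}"
  obtains \<mu> where "\<mu> \<in> {p + 1..n}" "\<xi> \<mu> < \<xi> (\<mu> + 1)" "x \<in> knot_interval (\<xi> (n + 1)) \<xi> \<mu>"
proof -
  have pn: "p + 1 \<le> n"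
  proof (rule ccontr)
    assume "\<not> p + 1 \<le> n"
    then have "\<xi> (n + 1) \<le> \<xi> (p + 1)"
      by (intro knots_le) auto
    then show False
      using ends by simp
  qed
  \<comment> \<open>The second condition matters for \<open>x\<close> at the right end: it keeps the
    maximum from selecting a degenerate interval there.\<close>
  define K where "K = {k \<in> {p + 1..n}. \<xi> k \<le> x \<and> \<xi> k < \<xi> (n + 1)}"
  define \<mu> where "\<mu> = Max K"
  have fin: "finite K"
    by (simp add: K_def)
  have "p + 1 \<in> K"
    using assms ends pn by (simp add: K_def)
  then have \<mu>: "\<mu> \<in> K"
    unfolding \<mu>_def using fin by (intro Max_in) auto
  have next_notin: "\<mu> + 1 \<notin> K"
    using Max_ge[OF fin, of "\<mu> + 1"] by (auto simp: \<mu>_def)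
  have "\<xi> (\<mu> + 1) \<le> \<xi> (n + 1)"
    using \<mu> by (intro knots_le) (auto simp: K_def)
  then consider "x < \<xi> (\<mu> + 1)" | "\<xi> (\<mu> + 1) = \<xi> (n + 1)"
    using \<mu> next_notin by (cases "\<mu> = n") (fastforce simp: K_def)+
  then have "\<xi> \<mu> < \<xi> (\<mu> + 1) \<and> x \<in> knot_interval (\<xi> (n + 1)) \<xi> \<mu>"
    using \<mu> assms by cases (auto simp: K_def knot_interval_def)
  then show thesis
    using that[of \<mu>] \<mu> by (auto simp: K_def)
qed

lemma bspline_comb_eq_poly:
  assumes "\<mu> \<in> {p + 1..n}" "\<xi> \<mu> < \<xi> (\<mu> + 1)" "x \<in> knot_interval (\<xi> (n + 1)) \<xi> \<mu>"
  shows "bspline_comb p n \<xi> c x = poly (\<Sum>i=\<mu> - p..\<mu>. smult (c i) (bspline_poly \<xi> \<mu> p i)) x"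
proof -
  have "bspline_comb p n \<xi> c x = (\<Sum>i=1..n. c i * poly (bspline_poly \<xi> \<mu> p i) x)"
    unfolding bspline_comb_def using assms
    by (intro sum.cong refl arg_cong2[of _ _ _ _ "(*)"] bspline_eq_bspline_poly[OF knots_mono])
       (auto intro: knots_le)
  also have "\<dots> = (\<Sum>i=\<mu> - p..\<mu>. c i * poly (bspline_poly \<xi> \<mu> p i) x)"
  proof (intro sum.mono_neutral_right ballI)
    fix i
    assume "i \<in> {1..n} - {\<mu> - p..\<mu>}"
    then show "c i * poly (bspline_poly \<xi> \<mu> p i) x = 0"
      using assms(1) by (subst bspline_poly_eq_0) auto
  qed (use assms(1) in auto)
  finally show ?thesis
    by (simp add: poly_sum)
qed

lemma infinite_knot_interval:
  assumes "\<mu> \<le> n" "\<xi> \<mu> < \<xi> (\<mu> + 1)"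
  shows "infinite (knot_interval (\<xi> (n + 1)) \<xi> \<mu>)"
proof
  assume "finite (knot_interval (\<xi> (n + 1)) \<xi> \<mu>)"
  moreover have "\<xi> (\<mu> + 1) \<le> \<xi> (n + 1)"
    using assms by (intro knots_le) auto
  then have "{\<xi> \<mu><..<\<xi> (\<mu> + 1)} \<subseteq> knot_interval (\<xi> (n + 1)) \<xi> \<mu>"
    by (auto simp: knot_interval_def)
  ultimately have "finite {\<xi> \<mu><..<\<xi> (\<mu> + 1)}"
    by (rule rev_finite_subset)
  then show False
    using assms(2) by (simp add: infinite_Ioo)
qed

lemma knot_interval_subset:
  assumes "\<mu> \<in> {p + 1..n}"
  shows "knot_interval (\<xi> (n + 1)) \<xi> \<mu> \<subseteq> {\<xi> (p + 1)..\<xi> (n + 1)}"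
proof -
  have "\<xi> (p + 1) \<le> \<xi> \<mu>"
    using assms by (intro knots_le) auto
  then show ?thesis
    by (auto simp: knot_interval_def)
qed

end

text \<open>Each B-spline has a nontrivial knot interval of its support inside the basic interval;
  this makes its coefficient recoverable from values there.\<close>

locale basic_knot_vector_supported = knot_vector +
  assumes support: "i \<in> {1..n} \<Longrightarrow> \<exists>\<mu>\<in>{p + 1..n}. i \<le> \<mu> \<and> \<mu> \<le> i + p \<and> \<xi> \<mu> < \<xi> (\<mu> + 1)"
begin

text \<open>On a nontrivial interval in the support of B-spline \<open>i\<close>, the two
  combinations are polynomials agreeing at infinitely many points. Pairing with the dual polynomial
  extracts the coefficient.\<close>

lemma bspline_comb_unique:
  assumes eq: "\<And>x. x \<in> {\<xi> (p + 1)..\<xi> (n + 1)} \<Longrightarrow> bspline_comb p n \<xi> c x = bspline_comb p n \<xi> c' x"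
    and i: "i \<in> {1..n}"
  shows "c i = c' i"
proof -
  obtain \<mu> where \<mu>: "\<mu> \<in> {p + 1..n}" "i \<le> \<mu>" "\<mu> \<le> i + p" "\<xi> \<mu> < \<xi> (\<mu> + 1)"
    using support[OF i] by blast
  interpret knot_piece p \<mu> \<xi>
    using \<mu> by (intro knot_piece)
  let ?q = "\<lambda>c. \<Sum>i=\<mu> - p..\<mu>. smult (c i) (bspline_poly \<xi> \<mu> p i)"
  have "infinite {x. poly (?q c - ?q c') x = 0}"
  proof (rule infinite_super)
    show "knot_interval (\<xi> (n + 1)) \<xi> \<mu> \<subseteq> {x. poly (?q c - ?q c') x = 0}"
    proof
      fix x
      assume x: "x \<in> knot_interval (\<xi> (n + 1)) \<xi> \<mu>"
      then have "x \<in> {\<xi> (p + 1)..\<xi> (n + 1)}"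
        using knot_interval_subset[OF \<mu>(1)] by blast
      then show "x \<in> {x. poly (?q c - ?q c') x = 0}"
        using eq[of x] unfolding bspline_comb_eq_poly[OF \<mu>(1,4) x] by simp
    qed
    show "infinite (knot_interval (\<xi> (n + 1)) \<xi> \<mu>)"
      using \<mu> by (intro infinite_knot_interval) auto
  qed
  then have "?q c = ?q c'"
    using poly_roots_finite[of "?q c - ?q c'"] by auto
  moreover have "i \<in> {\<mu> - p..\<mu>}"
    using \<mu> by auto
  ultimately show ?thesis
    using pairing_bspline_sum[of i c 0] pairing_bspline_sum[of i c' 0] by simp
qed

lemma bspline_coeffs_eq:
  assumes s: "\<And>x. x \<in> {\<xi> (p + 1)..\<xi> (n + 1)} \<Longrightarrow> s x = bspline_comb p n \<xi> c x"
    and i: "i \<in> {1..n}"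
  shows "bspline_coeffs p n \<xi> s i = c i"
proof -
  let ?P = "\<lambda>c. (\<forall>i. i \<notin> {1..n} \<longrightarrow> c i = 0) \<and>
      (\<forall>x\<in>{\<xi> (p + 1)..\<xi> (n + 1)}. s x = bspline_comb p n \<xi> c x)"
  \<comment> \<open>The definite description in \<open>bspline_coeffs\<close> demands zeros outside
    the index range.\<close>
  define c' where "c' i = (if i \<in> {1..n} then c i else 0)" for i
  have "bspline_comb p n \<xi> c' = bspline_comb p n \<xi> c"
    by (auto simp: fun_eq_iff bspline_comb_def c'_def intro!: sum.cong)
  then have "?P c'"
    using s by (auto simp: c'_def)
  moreover have "d = c'" if "?P d" for d
  proof
    fix k
    show "d k = c' k"
      using that \<open>?P c'\<close> bspline_comb_unique[of d c' k] by (cases "k \<in> {1..n}") auto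
  qed
  ultimately have "bspline_coeffs p n \<xi> s = c'"
    unfolding bspline_coeffs_def by (rule the_equality)
  then show ?thesis
    using i by (simp add: c'_def)
qed

lemma knot_norm_eq:
  assumes "\<And>x. x \<in> {\<xi> (p + 1)..\<xi> (n + 1)} \<Longrightarrow> s x = bspline_comb p n \<xi> c x"
  shows "knot_norm p n \<xi> s = sqrt (\<Sum>i=1..n. (c i)\<^sup>2 * (knot_weight p \<xi> i)\<^sup>2)"
  unfolding knot_norm_def using bspline_coeffs_eq[OF assms]
  by (intro arg_cong[of _ _ sqrt] sum.cong) auto

end

section \<open>Knot insertion\<close>

locale knot_removal = knot_vector +
  fixes r :: nat
  assumes p_pos: "1 \<le> p"
    and r_ge: "p + 2 \<le> r" and r_le: "r \<le> n"
    and r_last: "\<xi> r < \<xi> (r + 1)"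
    and support_pos: "i \<in> {1..n} \<Longrightarrow> \<xi> i < \<xi> (i + p + 1)"
begin

text \<open>Boehm's knot insertion coefficients. The values 1 and 0 belong to dual polynomials that
  do not contain knot \<open>r\<close> in an interior position and are merely kept or
  reindexed.\<close>

definition insertion_weight :: "nat \<Rightarrow> real" where
  "insertion_weight i =
     (if i + p < r then 1 else if r \<le> i then 0 else (\<xi> r - \<xi> i) / (\<xi> (i + p + 1) - \<xi> i))"

lemma knot_vector_remove_knot: "knot_vector p (n - 1) (remove_knot r \<xi>)"
proof
  show "mono_on {1..n - 1 + p + 1} (remove_knot r \<xi>)"
    using r_ge r_le by (intro mono_onI) (auto simp: remove_knot_def intro: knots_le)
  show "remove_knot r \<xi> (p + 1) < remove_knot r \<xi> (n - 1 + 1)"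
    using r_ge r_le ends by (auto simp: remove_knot_def)
qed

text \<open>If knot \<open>r\<close> is a zero of the dual polynomial, both reduced polynomials
  share the other \<open>p - 1\<close> factors, called \<open>C\<close>. The factor at
  \<open>\<xi> r\<close> is then the affine combination of those at \<open>\<xi> (i + p + 1)\<close>
  and \<open>\<xi> i\<close>.\<close>

lemma dual_poly_insertion:
  assumes "i \<in> {1..n}"
  shows "dual_poly \<xi> p i = smult (insertion_weight i) (dual_poly (remove_knot r \<xi>) p i) +
    smult (1 - insertion_weight i) (dual_poly (remove_knot r \<xi>) p (i - 1))"
proof -
  consider "i + p < r" | "r \<le> i" | "i < r" "r \<le> i + p"
    by linarith
  then show ?thesis
  proof cases
    case 1
    then have "dual_poly (remove_knot r \<xi>) p i = dual_poly \<xi> p i"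
      unfolding dual_poly_def by (intro prod.cong) (auto simp: remove_knot_def)
    then show ?thesis
      using 1 by (simp add: insertion_weight_def)
  next
    case 2
    have "dual_poly \<xi> p i = (\<Prod>k=Suc (i - 1 + 1)..Suc (i - 1 + p). [:- \<xi> k, 1:])"
      using assms by (simp add: dual_poly_def)
    also have "\<dots> = (\<Prod>k=i - 1 + 1..i - 1 + p. [:- \<xi> (Suc k), 1:])"
      by (rule prod.shift_bounds_cl_Suc_ivl)
    also have "\<dots> = dual_poly (remove_knot r \<xi>) p (i - 1)"
      unfolding dual_poly_def using 2 by (intro prod.cong) (auto simp: remove_knot_def)
    finally show ?thesis
      using 2 by (simp add: insertion_weight_def)
  next
    case 3
    define C where "C = dual_poly (remove_knot r \<xi>) (p - 1) i"
    have p: "p = Suc (p - 1)"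
      using p_pos by simp
    have 1: "dual_poly \<xi> p i = [:- \<xi> r, 1:] * C"
      using dual_poly_remove_knot[of i r "p - 1" \<xi>] 3 p unfolding C_def by simp
    have "remove_knot r \<xi> (i + (p - 1) + 1) = \<xi> (i + p + 1)" "remove_knot r \<xi> i = \<xi> i"
      using 3 p_pos by (auto simp: remove_knot_def)
    then have 2: "dual_poly (remove_knot r \<xi>) p i = [:- \<xi> (i + p + 1), 1:] * C"
      "dual_poly (remove_knot r \<xi>) p (i - 1) = [:- \<xi> i, 1:] * C"
      using dual_poly_Suc[of "remove_knot r \<xi>" "p - 1" i]
        dual_poly_Suc'[of "remove_knot r \<xi>" "p - 1" "i - 1"] assms p
      unfolding C_def by (simp_all add: mult.commute)
    have A: "insertion_weight i * (\<xi> (i + p + 1) - \<xi> i) = \<xi> r - \<xi> i"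
      using 3 support_pos[OF assms] by (simp add: insertion_weight_def)
    have "[:- \<xi> r, 1:] = smult (insertion_weight i) [:- \<xi> (i + p + 1), 1:] +
        smult (1 - insertion_weight i) [:- \<xi> i, 1:]"
      using A by (simp add: algebra_simps)
    then show ?thesis
      unfolding 1 2 by (simp only: distrib_right mult_smult_left)
  qed
qed

lemma pairing_insertion:
  assumes "i \<in> {1..n}"
  shows "pairing p (dual_poly \<xi> p i) q t =
    insertion_weight i * pairing p (dual_poly (remove_knot r \<xi>) p i) q t +
    (1 - insertion_weight i) * pairing p (dual_poly (remove_knot r \<xi>) p (i - 1)) q t"
  by (subst dual_poly_insertion[OF assms]) (simp only: pairing_add_left pairing_smult_left)

text \<open>On each knot interval the reduced spline is a polynomial whose pairings with the reduced
  dual polynomials are the \<open>d i\<close>. By \<open>pairing_insertion\<close> its pairings with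
  the fine ones are the \<open>c i\<close>, and \<open>reproduction\<close> rebuilds it from
  these.\<close>

lemma knot_insertion:
  assumes c: "\<And>i. i \<in> {1..n} \<Longrightarrow> c i = insertion_weight i * d i + (1 - insertion_weight i) * d (i - 1)"
    and x: "x \<in> {\<xi> (p + 1)..\<xi> (n + 1)}"
  shows "bspline_comb p (n - 1) (remove_knot r \<xi>) d x = bspline_comb p n \<xi> c x"
proof -
  define \<eta> where "\<eta> = remove_knot r \<xi>"
  interpret red: knot_vector p "n - 1" \<eta>
    unfolding \<eta>_def by (rule knot_vector_remove_knot)
  obtain \<mu> where \<mu>: "\<mu> \<in> {p + 1..n}" "\<xi> \<mu> < \<xi> (\<mu> + 1)" "x \<in> knot_interval (\<xi> (n + 1)) \<xi> \<mu>"
    using ex_knot_interval[OF x] .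
  interpret P: knot_piece p \<mu> \<xi>
    using \<mu> by (intro knot_piece)
  \<comment> \<open>The reduced knot interval containing interval \<open>\<mu>\<close>; the two
    intervals adjacent to knot \<open>r\<close> both map to \<open>r - 1\<close>.\<close>
  define \<nu> where "\<nu> = (if \<mu> < r then \<mu> else \<mu> - 1)"
  have \<nu>: "\<nu> \<in> {p + 1..n - 1}"
    using \<mu>(1) r_ge r_le by (auto simp: \<nu>_def)
  have b: "\<eta> (n - 1 + 1) = \<xi> (n + 1)"
    using r_ge r_le by (simp add: \<eta>_def remove_knot_def)
  have "\<xi> (r + 1) \<le> \<xi> (n + 1)"
    using r_le by (intro knots_le) auto
  then have "\<eta> \<nu> < \<eta> (\<nu> + 1) \<and> x \<in> knot_interval (\<xi> (n + 1)) \<eta> \<nu>"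
  proof -
    assume le: "\<xi> (r + 1) \<le> \<xi> (n + 1)"
    consider "\<mu> + 1 < r" | "\<mu> + 1 = r" | "\<mu> = r" | "r < \<mu>"
      by linarith
    then show ?thesis
    proof cases
      case 1
      then have "\<eta> \<nu> = \<xi> \<mu>" "\<eta> (\<nu> + 1) = \<xi> (\<mu> + 1)"
        by (auto simp: \<nu>_def \<eta>_def remove_knot_def)
      then show ?thesis
        using \<mu> by (auto simp: knot_interval_def)
    next
      case 2
      then have "\<eta> \<nu> = \<xi> \<mu>" "\<eta> (\<nu> + 1) = \<xi> (r + 1)"
        by (auto simp: \<nu>_def \<eta>_def remove_knot_def)
      then show ?thesis
        using \<mu> 2 r_last le by (auto simp: knot_interval_def split: if_splits)
    next
      case 3
      then have "\<eta> \<nu> = \<xi> (\<mu> - 1)" "\<eta> (\<nu> + 1) = \<xi> (\<mu> + 1)" "\<xi> (\<mu> - 1) \<le> \<xi> \<mu>"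
        using r_ge r_le by (auto simp: \<nu>_def \<eta>_def remove_knot_def intro: knots_le)
      then show ?thesis
        using \<mu> by (auto simp: knot_interval_def split: if_splits)
    next
      case 4
      then have "\<eta> \<nu> = \<xi> \<mu>" "\<eta> (\<nu> + 1) = \<xi> (\<mu> + 1)"
        by (auto simp: \<nu>_def \<eta>_def remove_knot_def)
      then show ?thesis
        using \<mu> by (auto simp: knot_interval_def)
    qed
  qed
  then have \<nu>': "\<eta> \<nu> < \<eta> (\<nu> + 1)" "x \<in> knot_interval (\<eta> (n - 1 + 1)) \<eta> \<nu>"
    unfolding b by auto
  interpret Q: knot_piece p \<nu> \<eta>
    using \<nu> \<nu>' by (intro red.knot_piece)
  define q where "q = (\<Sum>i=\<nu> - p..\<nu>. smult (d i) (bspline_poly \<eta> \<nu> p i))"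
  have deg: "degree q \<le> p"
    unfolding q_def by (intro degree_sum_le order.trans[OF degree_smult_le] degree_bspline_poly) auto
  have pairing_q: "pairing p (dual_poly \<eta> p i) q 0 = d i" if "i \<in> {\<nu> - p..\<nu>}" for i
    unfolding q_def using that by (rule Q.pairing_bspline_sum)
  have coeff: "pairing p (dual_poly \<xi> p i) q 0 = c i" if i: "i \<in> {\<mu> - p..\<mu>}" for i
  proof -
    have i': "i \<in> {1..n}"
      using i \<mu>(1) by auto
    have "insertion_weight i * pairing p (dual_poly \<eta> p i) q 0 = insertion_weight i * d i"
      \<comment> \<open>An index outside the active range of \<open>\<nu>\<close> carries the factor
        0, here and in the next claim.\<close>
      using pairing_q[of i] i by (cases "i \<in> {\<nu> - p..\<nu>}") (auto simp: \<nu>_def insertion_weight_def split: if_splits)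
    moreover have "(1 - insertion_weight i) * pairing p (dual_poly \<eta> p (i - 1)) q 0 =
        (1 - insertion_weight i) * d (i - 1)"
      using pairing_q[of "i - 1"] i \<mu>(1) by (cases "i - 1 \<in> {\<nu> - p..\<nu>}") (auto simp: \<nu>_def insertion_weight_def split: if_splits)
    ultimately show ?thesis
      unfolding pairing_insertion[OF i'] c[OF i'] \<eta>_def[symmetric] by (simp only:)
  qed
  have "bspline_comb p (n - 1) \<eta> d x = poly q x"
    unfolding q_def using \<nu> \<nu>' by (intro red.bspline_comb_eq_poly)
  also have "\<dots> = (\<Sum>i=\<mu> - p..\<mu>. c i * poly (bspline_poly \<xi> \<mu> p i) x)"
    unfolding P.reproduction[OF deg, of x 0] using coeff by (intro sum.cong) auto
  also have "\<dots> = bspline_comb p n \<xi> c x"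
    unfolding bspline_comb_eq_poly[OF \<mu>] by (simp add: poly_sum)
  finally show ?thesis
    by (simp add: \<eta>_def)
qed

end

section \<open>The functional annihilating the reduced space\<close>

locale knot_removal_mult = knot_removal +
  fixes l :: nat
  assumes l_le: "l \<le> p"
    and r_mult: "k \<in> {r - l..r} \<Longrightarrow> \<xi> k = \<xi> r"
    and r_first: "\<xi> (r - l - 1) < \<xi> r"
begin

text \<open>The indices \<open>off + j\<close> for \<open>j\<close> from 1 to \<open>width\<close>
  run from \<open>r - p - 1\<close> to \<open>r - l\<close>; they carry the local numbering of
  \<open>alpha\<close>, \<open>mu\<close> and \<open>loc_weight\<close>.\<close>

abbreviation "off \<equiv> r - (p + 2)"
abbreviation "width \<equiv> p + 2 - l"

text \<open>The coefficients of the linear relation among consecutive dual polynomials, normalized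
  to 1 at \<open>width\<close>, where the product is empty.\<close>

definition annihilator :: "nat \<Rightarrow> real" where
  "annihilator j = (\<Prod>i=j..p + 1 - l. - mu p \<xi> r i)"

lemma insertion_weight_eq_1: "i \<le> off + 1 \<Longrightarrow> insertion_weight i = 1"
  using r_ge by (auto simp: insertion_weight_def)

text \<open>From \<open>r - l\<close> up to \<open>r\<close> the knots coincide with
  \<open>\<xi> r\<close>, so the numerator vanishes.\<close>

lemma insertion_weight_eq_0: "off + width \<le> i \<Longrightarrow> insertion_weight i = 0"
  using r_ge l_le r_mult[of i] by (auto simp: insertion_weight_def)

text \<open>The quotient \<open>alpha\<close> also gives the right value at the ends: it is 1 for
  \<open>j = 1\<close>, where \<open>off + j + p + 1 = r\<close>, and 0 if
  \<open>off + j = r\<close>.\<close>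

lemma alpha_eq_insertion_weight:
  assumes "j \<in> {1..width}"
  shows "alpha p \<xi> r j = insertion_weight (off + j)"
proof -
  have index: "r + j - 1 = off + j + p + 1" "r + j - (p + 2) = off + j"
    using assms r_ge by auto
  have alpha: "alpha p \<xi> r j = (\<xi> r - \<xi> (off + j)) / (\<xi> (off + j + p + 1) - \<xi> (off + j))"
    unfolding alpha_def index ..
  consider "j = 1" | "r \<le> off + j" | "j \<noteq> 1" "off + j < r"
    by linarith
  then show ?thesis
  proof cases
    case 1
    have "\<xi> (off + 1) \<le> \<xi> (r - l - 1)"
      using r_ge r_le l_le by (intro knots_le) auto
    moreover have off: "off + 1 + p + 1 = r"
      using r_ge by simp
    ultimately have "alpha p \<xi> r j = 1"
      using r_first alpha unfolding 1 off by simp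
    then show ?thesis
      using 1 insertion_weight_eq_1[of "off + 1"] by simp
  next
    case 2
    then have "off + j = r"
      using assms r_ge by auto
    then show ?thesis
      unfolding alpha by (simp add: insertion_weight_def)
  next
    case 3
    then have "\<not> off + j + p < r"
      using assms r_ge by auto
    then show ?thesis
      using 3 unfolding alpha by (simp add: insertion_weight_def)
  qed
qed

lemma insertion_weight_pos:
  assumes "j \<in> {1..<width}"
  shows "0 < insertion_weight (off + j)"
proof -
  have "\<xi> (off + j) \<le> \<xi> (r - l - 1)"
    using assms r_ge r_le l_le by (intro knots_le) auto
  then show ?thesis
    using assms r_first support_pos[of "off + j"] r_ge r_le l_le by (auto simp: insertion_weight_def)
qed

lemma insertion_weight_less_1:
  assumes "j \<in> {2..width}"
  shows "insertion_weight (off + j) < 1"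
proof -
  have "\<xi> (r + 1) \<le> \<xi> (off + j + p + 1)"
    using assms r_ge r_le l_le by (intro knots_le) auto
  then show ?thesis
    using assms r_last support_pos[of "off + j"] r_ge r_le l_le
    by (auto simp: insertion_weight_def divide_less_eq)
qed

lemma annihilator_width: "annihilator width = 1"
  using l_le by (simp add: annihilator_def)

text \<open>This balance is what dictates the ratio \<open>mu\<close>: the two contributions of each
  reduced coefficient cancel.\<close>

lemma annihilator_step:
  assumes "j \<in> {1..<width}"
  shows "annihilator j * insertion_weight (off + j) =
    - annihilator (j + 1) * (1 - insertion_weight (off + (j + 1)))"
proof -
  have "{j..p + 1 - l} = insert j {j + 1..p + 1 - l}"
    using assms by auto
  then have "annihilator j = - mu p \<xi> r j * annihilator (j + 1)"
    by (simp add: annihilator_def)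
  then have "annihilator j * insertion_weight (off + j) =
      - annihilator (j + 1) * (mu p \<xi> r j * insertion_weight (off + j))"
    by (simp only: mult.assoc mult.commute mult.left_commute mult_minus_left mult_minus_right)
  also have "mu p \<xi> r j * insertion_weight (off + j) = 1 - insertion_weight (off + (j + 1))"
    using assms insertion_weight_pos[OF assms] alpha_eq_insertion_weight[of j]
      alpha_eq_insertion_weight[of "j + 1"] by (simp add: mu_def)
  finally show ?thesis .
qed

lemma annihilator_nonzero:
  assumes "j \<in> {1..width}"
  shows "annihilator j \<noteq> 0"
proof -
  have "mu p \<xi> r i \<noteq> 0" if "i \<in> {j..p + 1 - l}" for i
  proof -
    have "i \<in> {1..<width}" "i + 1 \<in> {2..width}" "i \<in> {1..width}" "i + 1 \<in> {1..width}"
      using that assms l_le by auto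
    then show ?thesis
      using insertion_weight_pos[of i] insertion_weight_less_1[of "i + 1"]
        alpha_eq_insertion_weight[of i] alpha_eq_insertion_weight[of "i + 1"]
      by (simp add: mu_def)
  qed
  then show ?thesis
    by (simp add: annihilator_def)
qed

text \<open>By \<open>annihilator_step\<close> the sum telescopes: of the reduced coefficients met
  so far, only the newest remains. It starts cleanly because the weight at \<open>off + 1\<close> is
  1.\<close>

lemma annihilator_partial_sum:
  fixes d :: "nat \<Rightarrow> real"
  defines "F \<equiv> \<lambda>j. annihilator j * (insertion_weight (off + j) * d (off + j) +
      (1 - insertion_weight (off + j)) * d (off + j - 1))"
  assumes "k \<in> {1..width}"
  shows "sum F {1..k} = annihilator k * insertion_weight (off + k) * d (off + k)"
  using assms(2)
proof (induction k)
  case (Suc k)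
  show ?case
  proof (cases "k = 0")
    case True
    then show ?thesis
      using insertion_weight_eq_1[of "off + 1"] by (simp add: F_def)
  next
    case False
    then have "sum F {1..k} = annihilator k * insertion_weight (off + k) * d (off + k)"
      using Suc by auto
    also have "\<dots> = - annihilator (Suc k) * (1 - insertion_weight (off + Suc k)) * d (off + k)"
      using annihilator_step[of k] False Suc.prems by simp
    finally have "sum F {1..Suc k} =
        - annihilator (Suc k) * (1 - insertion_weight (off + Suc k)) * d (off + k) + F (Suc k)"
      by simp
    moreover have "F (Suc k) = annihilator (Suc k) * insertion_weight (off + Suc k) * d (off + Suc k) +
        annihilator (Suc k) * (1 - insertion_weight (off + Suc k)) * d (off + k)"
      by (simp add: F_def distrib_left)
    ultimately show ?thesis
      by simp
  qed
qed simp

text \<open>The one remaining term of the full sum has insertion weight 0.\<close>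

lemma annihilator_insertion:
  assumes "\<And>i. i \<in> {1..n} \<Longrightarrow> c i = insertion_weight i * d i + (1 - insertion_weight i) * d (i - 1)"
  shows "(\<Sum>j=1..width. annihilator j * c (off + j)) = 0"
proof -
  have "(\<Sum>j=1..width. annihilator j * c (off + j)) =
      (\<Sum>j=1..width. annihilator j * (insertion_weight (off + j) * d (off + j) +
        (1 - insertion_weight (off + j)) * d (off + j - 1)))"
  proof (intro sum.cong refl)
    fix j
    assume "j \<in> {1..width}"
    then have "off + j \<in> {1..n}"
      using r_ge r_le by auto
    then show "annihilator j * c (off + j) = annihilator j * (insertion_weight (off + j) * d (off + j) +
        (1 - insertion_weight (off + j)) * d (off + j - 1))"
      by (simp only: assms)
  qed
  also have "\<dots> = annihilator width * insertion_weight (off + width) * d (off + width)"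
    using l_le by (intro annihilator_partial_sum) auto
  finally show ?thesis
    by (simp add: insertion_weight_eq_0)
qed

text \<open>Pairings with the dual polynomials satisfy the insertion recursion, so they inherit the
  relation; \<open>q\<close> is arbitrary.\<close>

lemma annihilator_pairing:
  "(\<Sum>j=1..width. annihilator j * pairing p (dual_poly \<xi> p (off + j)) q t) = 0"
  by (rule annihilator_insertion[OF pairing_insertion])

text \<open>The converse of \<open>annihilator_insertion\<close>: the telescoped partial sums can be
  solved for the reduced coefficients.\<close>

lemma ex_insertion:
  assumes c: "(\<Sum>j=1..width. annihilator j * c (off + j)) = 0"
  obtains d where "\<And>i. i \<in> {1..n} \<Longrightarrow> c i = insertion_weight i * d i + (1 - insertion_weight i) * d (i - 1)"
proof -
  define S where "S k = (\<Sum>j=1..k. annihilator j * c (off + j))" for k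
  \<comment> \<open>The middle case inverts \<open>annihilator_partial_sum\<close>. Outside it the
    insertion weights are 1 and 0, so coefficients are copied, with a shift by one on the
    right.\<close>
  define d where "d i = (if i \<le> off then c i else if i < off + width
      then S (i - off) / (annihilator (i - off) * insertion_weight i) else c (i + 1))" for i
  have S_Suc: "S (Suc k) = S k + annihilator (Suc k) * c (off + Suc k)" for k
    by (simp add: S_def)
  have left: "annihilator j * (insertion_weight (off + j) * d (off + j)) = S j" if "j \<in> {1..<width}" for j
    using that insertion_weight_pos[OF that] annihilator_nonzero[of j] by (simp add: d_def)
  have right: "annihilator j * ((1 - insertion_weight (off + j)) * d (off + j - 1)) = - S (j - 1)"
    if "j \<in> {2..width}" for j
  proof -
    have "j - 1 \<in> {1..<width}"
      using that by auto
    moreover have "off + (j - 1) = off + j - 1" "j - 1 + 1 = j"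
      using that by auto
    ultimately show ?thesis
      using left[of "j - 1"] annihilator_step[of "j - 1"] by (simp add: mult.assoc[symmetric])
  qed
  have "c i = insertion_weight i * d i + (1 - insertion_weight i) * d (i - 1)" if i: "i \<in> {1..n}" for i
  proof -
    consider "i \<le> off" | "off + width < i" | "i \<in> {off + 1..off + width}"
      by force
    then show ?thesis
    proof cases
      case 1
      then show ?thesis
        by (simp add: insertion_weight_eq_1 d_def)
    next
      case 2
      then show ?thesis
        using l_le by (auto simp: insertion_weight_eq_0 d_def)
    next
      case 3
      define j where "j = i - off"
      have j: "j \<in> {1..width}" "i = off + j"
        using 3 by (auto simp: j_def)
      have "annihilator j * (insertion_weight i * d i) = S j"
      proof (cases "j = width")
        case True
        then show ?thesis
          \<comment> \<open>The hypothesis on \<open>c\<close> enters here: the last weight is 0, so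
            the full sum must vanish as well.\<close>
          using c j by (simp add: insertion_weight_eq_0 S_def)
      next
        case False
        then show ?thesis
          using left[of j] j by auto
      qed
      moreover have "annihilator j * ((1 - insertion_weight i) * d (i - 1)) = - S (j - 1)"
      proof (cases "j = 1")
        case True
        then show ?thesis
          using j insertion_weight_eq_1[of i] by (simp add: S_def)
      next
        case False
        then show ?thesis
          using right[of j] j by auto
      qed
      moreover have "S j = S (j - 1) + annihilator j * c i"
        using S_Suc[of "j - 1"] j by simp
      ultimately have "annihilator j * (insertion_weight i * d i + (1 - insertion_weight i) * d (i - 1)) =
          annihilator j * c i"
        by (simp only: distrib_left)
      then show ?thesis
        using annihilator_nonzero[OF j(1)] by simp
    qed
  qed
  then show thesis
    by (rule that)
qed

lemma mem_reduced_space_iff: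
  "g \<in> reduced_space p n \<xi> r \<longleftrightarrow>
    (\<exists>c. (\<Sum>j=1..width. annihilator j * c (off + j)) = 0 \<and>
      (\<forall>x\<in>{\<xi> (p + 1)..\<xi> (n + 1)}. g x = bspline_comb p n \<xi> c x))"
proof -
  have ends_remove_knot: "remove_knot r \<xi> (p + 1) = \<xi> (p + 1)" "remove_knot r \<xi> (n - 1 + 1) = \<xi> (n + 1)"
    using r_ge r_le by (auto simp: remove_knot_def)
  show ?thesis
  proof
    assume "g \<in> reduced_space p n \<xi> r"
    then obtain d where d: "\<And>x. x \<in> {\<xi> (p + 1)..\<xi> (n + 1)} \<Longrightarrow> g x = bspline_comb p (n - 1) (remove_knot r \<xi>) d x"
      unfolding reduced_space_def bspline_span_def ends_remove_knot by blast
    define c where "c i = insertion_weight i * d i + (1 - insertion_weight i) * d (i - 1)" for i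
    show "\<exists>c. (\<Sum>j=1..width. annihilator j * c (off + j)) = 0 \<and>
      (\<forall>x\<in>{\<xi> (p + 1)..\<xi> (n + 1)}. g x = bspline_comb p n \<xi> c x)"
      using annihilator_insertion[OF c_def] knot_insertion[OF c_def] d by auto
  next
    assume "\<exists>c. (\<Sum>j=1..width. annihilator j * c (off + j)) = 0 \<and>
      (\<forall>x\<in>{\<xi> (p + 1)..\<xi> (n + 1)}. g x = bspline_comb p n \<xi> c x)"
    then obtain c where c: "(\<Sum>j=1..width. annihilator j * c (off + j)) = 0"
      "\<And>x. x \<in> {\<xi> (p + 1)..\<xi> (n + 1)} \<Longrightarrow> g x = bspline_comb p n \<xi> c x"
      by blast
    obtain d where "\<And>i. i \<in> {1..n} \<Longrightarrow> c i = insertion_weight i * d i + (1 - insertion_weight i) * d (i - 1)"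
      using ex_insertion[OF c(1)] by blast
    then have "g x = bspline_comb p (n - 1) (remove_knot r \<xi>) d x" if "x \<in> {\<xi> (p + 1)..\<xi> (n + 1)}" for x
      using knot_insertion[of c d x] c(2) that by auto
    then show "g \<in> reduced_space p n \<xi> r"
      unfolding reduced_space_def bspline_span_def ends_remove_knot by blast
  qed
qed

end

section \<open>Distance to a hyperplane in a weighted norm\<close>

text \<open>Cauchy--Schwarz for the vectors \<open>a i / w i\<close> and
  \<open>v i * w i\<close>.\<close>

lemma weighted_hyperplane_bound:
  fixes a v w :: "'i \<Rightarrow> real"
  assumes w: "\<And>i. i \<in> I \<Longrightarrow> 0 < w i"
    and Q: "0 < (\<Sum>i\<in>I. (a i)\<^sup>2 / (w i)\<^sup>2)"
  shows "\<bar>\<Sum>i\<in>I. a i * v i\<bar> / sqrt (\<Sum>i\<in>I. (a i)\<^sup>2 / (w i)\<^sup>2) \<le> sqrt (\<Sum>i\<in>I. (v i)\<^sup>2 * (w i)\<^sup>2)"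
proof -
  have "(\<Sum>i\<in>I. (a i / w i) * (v i * w i))\<^sup>2 \<le> (\<Sum>i\<in>I. (a i / w i)\<^sup>2) * (\<Sum>i\<in>I. (v i * w i)\<^sup>2)"
    by (rule Cauchy_Schwarz_ineq_sum)
  moreover have "(\<Sum>i\<in>I. (a i / w i) * (v i * w i)) = (\<Sum>i\<in>I. a i * v i)"
    using w by (intro sum.cong) (auto simp: less_imp_neq[symmetric])
  ultimately have "(\<Sum>i\<in>I. a i * v i)\<^sup>2 \<le> (\<Sum>i\<in>I. (a i)\<^sup>2 / (w i)\<^sup>2) * (\<Sum>i\<in>I. (v i)\<^sup>2 * (w i)\<^sup>2)"
    by (simp add: power_divide power_mult_distrib)
  then have "\<bar>\<Sum>i\<in>I. a i * v i\<bar> \<le> sqrt ((\<Sum>i\<in>I. (a i)\<^sup>2 / (w i)\<^sup>2) * (\<Sum>i\<in>I. (v i)\<^sup>2 * (w i)\<^sup>2))"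
    by (intro real_le_rsqrt) simp
  then show ?thesis
    using Q by (simp add: real_sqrt_mult divide_le_eq mult.commute)
qed

lemma weighted_hyperplane_attained:
  fixes a w :: "'i \<Rightarrow> real"
  assumes w: "\<And>i. i \<in> I \<Longrightarrow> 0 < w i"
    and Q: "0 < (\<Sum>i\<in>I. (a i)\<^sup>2 / (w i)\<^sup>2)"
  obtains v where "(\<Sum>i\<in>I. a i * v i) = t"
    and "sqrt (\<Sum>i\<in>I. (v i)\<^sup>2 * (w i)\<^sup>2) = \<bar>t\<bar> / sqrt (\<Sum>i\<in>I. (a i)\<^sup>2 / (w i)\<^sup>2)"
proof -
  define R where "R = (\<Sum>i\<in>I. (a i)\<^sup>2 / (w i)\<^sup>2)"
  \<comment> \<open>The equality case of Cauchy--Schwarz: \<open>v i * w i\<close> is proportional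
    to \<open>a i / w i\<close>, scaled to meet the constraint.\<close>
  define v where "v i = t / R * (a i / (w i)\<^sup>2)" for i
  have R: "R > 0"
    using Q by (simp add: R_def)
  have "(\<Sum>i\<in>I. a i * v i) = t / R * R"
    unfolding R_def v_def sum_distrib_left
    by (intro sum.cong) (auto simp: power2_eq_square)
  then have 1: "(\<Sum>i\<in>I. a i * v i) = t"
    using R by simp
  have "(\<Sum>i\<in>I. (v i)\<^sup>2 * (w i)\<^sup>2) = (t / R)\<^sup>2 * (\<Sum>i\<in>I. (a i)\<^sup>2 / (w i)\<^sup>2)"
    unfolding v_def sum_distrib_left using w
    by (intro sum.cong refl) (auto simp: power_mult_distrib power_divide less_imp_neq[symmetric] power2_eq_square mult_ac)
  also have "\<dots> = t\<^sup>2 / R"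
    unfolding R_def[symmetric] using R by (simp add: power2_eq_square)
  finally have "sqrt (\<Sum>i\<in>I. (v i)\<^sup>2 * (w i)\<^sup>2) = \<bar>t\<bar> / sqrt R"
    by (simp add: real_sqrt_divide)
  with 1 show thesis
    using that by (simp add: R_def)
qed

section \<open>The minimal error in terms of the coefficients\<close>

lemma bspline_comb_diff:
  "bspline_comb p n \<xi> c x - bspline_comb p n \<xi> d x = bspline_comb p n \<xi> (\<lambda>i. c i - d i) x"
  by (simp add: bspline_comb_def left_diff_distrib sum_subtractf)

lemma bspline_comb_add:
  "bspline_comb p n \<xi> (\<lambda>i. c i + d i) x = bspline_comb p n \<xi> c x + bspline_comb p n \<xi> d x"
  by (simp add: bspline_comb_def distrib_right sum.distrib)

context knot_removal_mult
begin

text \<open>Extension by zero, so that the functional and \<open>knot_norm\<close> are sums over the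
  same indices.\<close>

definition annihilator_ext :: "nat \<Rightarrow> real" where
  "annihilator_ext i = (if i \<in> {off + 1..off + width} then annihilator (i - off) else 0)"

lemma sum_annihilator_ext:
  assumes "\<And>i. F i 0 = (0 :: real)"
  shows "(\<Sum>i=1..n. F i (annihilator_ext i)) = (\<Sum>j=1..width. F (off + j) (annihilator j))"
proof -
  have "(\<Sum>i=1..n. F i (annihilator_ext i)) = (\<Sum>i\<in>{off + 1..off + width}. F i (annihilator_ext i))"
    using r_ge r_le assms by (intro sum.mono_neutral_right) (auto simp: annihilator_ext_def)
  also have "\<dots> = (\<Sum>j=1..width. F (off + j) (annihilator j))"
    by (rule sum.reindex_bij_witness[of _ "\<lambda>j. off + j" "\<lambda>i. i - off"])
       (auto simp: annihilator_ext_def)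
  finally show ?thesis .
qed

lemma knot_weight_pos: "i \<in> {1..n} \<Longrightarrow> 0 < knot_weight p \<xi> i"
  using support_pos[of i] by (simp add: knot_weight_def)

lemma loc_weight_eq: "loc_weight p \<xi> r j = knot_weight p \<xi> (off + j)"
  using r_ge by (simp add: loc_weight_def)

lemma loc_weight_pos: "j \<in> {1..width} \<Longrightarrow> 0 < loc_weight p \<xi> r j"
  unfolding loc_weight_eq using r_ge r_le by (intro knot_weight_pos) auto

lemma annihilator_square: "(annihilator j)\<^sup>2 = (\<Prod>i=j..p + 1 - l. (mu p \<xi> r i)\<^sup>2)"
  by (simp add: annihilator_def prod_power_distrib)

text \<open>Factoring the summand of index \<open>width\<close> out of \<open>Q\<close> leaves
  exactly the bracket under the root in \<open>gamma_loc\<close>. So the constant r of the claim is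
  the reciprocal of the dual norm of the functional.\<close>

lemma annihilator_norm:
  defines "Q \<equiv> \<Sum>i=1..n. (annihilator_ext i)\<^sup>2 / (knot_weight p \<xi> i)\<^sup>2"
  shows "0 < Q" and "1 / sqrt Q = gamma_loc p l \<xi> r * loc_weight p \<xi> r width"
proof -
  let ?e = "loc_weight p \<xi> r"
  define S where "S = (\<Sum>j=1..p + 1 - l. 1 / (?e j)\<^sup>2 * (\<Prod>i=j..p + 1 - l. (mu p \<xi> r i)\<^sup>2))"
  have e: "0 < ?e width"
    using l_le by (intro loc_weight_pos) auto
  have "S \<ge> 0"
    unfolding S_def by (intro sum_nonneg mult_nonneg_nonneg prod_nonneg) auto
  have "Q = (\<Sum>j=1..width. (annihilator j)\<^sup>2 / (?e j)\<^sup>2)"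
    unfolding Q_def loc_weight_eq
    by (rule sum_annihilator_ext[of "\<lambda>i z. z\<^sup>2 / (knot_weight p \<xi> i)\<^sup>2"]) simp
  also have "{1..width} = insert width {1..p + 1 - l}"
    using l_le by auto
  also have "(\<Sum>j\<in>\<dots>. (annihilator j)\<^sup>2 / (?e j)\<^sup>2) =
      (annihilator width)\<^sup>2 / (?e width)\<^sup>2 + (\<Sum>j=1..p + 1 - l. (annihilator j)\<^sup>2 / (?e j)\<^sup>2)"
    using l_le by (intro sum.insert) auto
  also have "\<dots> = 1 / (?e width)\<^sup>2 + S"
    unfolding annihilator_width by (simp add: S_def annihilator_square)
  finally have Q: "Q = (1 + (?e width)\<^sup>2 * S) / (?e width)\<^sup>2"
    using e by (simp add: field_simps)
  have pos: "0 < 1 + (?e width)\<^sup>2 * S"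
    using \<open>S \<ge> 0\<close> by (intro add_pos_nonneg) auto
  then show "0 < Q"
    unfolding Q using e by simp
  have "sqrt Q = sqrt (1 + (?e width)\<^sup>2 * S) / ?e width"
    unfolding Q real_sqrt_divide using e by simp
  then show "1 / sqrt Q = gamma_loc p l \<xi> r * ?e width"
    by (simp add: gamma_loc_def S_def)
qed

end

locale knot_removal_supported = knot_removal_mult + basic_knot_vector_supported
begin

text \<open>As \<open>g\<close> runs through the reduced space, the coefficients of
  \<open>g - s\<close> run through the affine hyperplane on which the functional equals minus its
  value at \<open>c\<close>. Attainment is stated separately because \<open>LEAST\<close> alone does
  not ensure it.\<close>

lemma removal_error_eq:
  assumes s: "\<And>x. x \<in> {\<xi> (p + 1)..\<xi> (n + 1)} \<Longrightarrow> s x = bspline_comb p n \<xi> c x"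
  shows "\<exists>g. is_arg_min (\<lambda>g. knot_norm p n \<xi> (\<lambda>x. g x - s x)) (\<lambda>g. g \<in> reduced_space p n \<xi> r) g"
    and "removal_error p n \<xi> r s =
      gamma_loc p l \<xi> r * loc_weight p \<xi> r width * \<bar>\<Sum>j=1..width. annihilator j * c (off + j)\<bar>"
proof -
  let ?w = "knot_weight p \<xi>"
  let ?dist = "\<lambda>g. knot_norm p n \<xi> (\<lambda>x. g x - s x)"
  define Q where "Q = (\<Sum>i=1..n. (annihilator_ext i)\<^sup>2 / (?w i)\<^sup>2)"
  define T where "T c = (\<Sum>i=1..n. annihilator_ext i * c i)" for c
  have T: "T c = (\<Sum>j=1..width. annihilator j * c (off + j))" for c
    unfolding T_def by (rule sum_annihilator_ext[of "\<lambda>i z. z * c i"]) simp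
  have T_diff: "T (\<lambda>i. d i - c i) = T d - T c" and T_add: "T (\<lambda>i. c i + d i) = T c + T d" for c d
    by (simp_all add: T_def distrib_left right_diff_distrib sum_subtractf sum.distrib)
  have Q: "0 < Q" "1 / sqrt Q = gamma_loc p l \<xi> r * loc_weight p \<xi> r width"
    using annihilator_norm unfolding Q_def .
  have lower: "\<bar>T c\<bar> / sqrt Q \<le> ?dist g" if g: "g \<in> reduced_space p n \<xi> r" for g
  proof -
    obtain d where d: "T d = 0" "\<forall>x\<in>{\<xi> (p + 1)..\<xi> (n + 1)}. g x = bspline_comb p n \<xi> d x"
      using g unfolding mem_reduced_space_iff T[symmetric] by blast
    have "?dist g = sqrt (\<Sum>i=1..n. (d i - c i)\<^sup>2 * (?w i)\<^sup>2)"
      using d s by (intro knot_norm_eq) (simp add: bspline_comb_diff)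
    moreover have "\<bar>T (\<lambda>i. d i - c i)\<bar> / sqrt Q \<le> sqrt (\<Sum>i=1..n. (d i - c i)\<^sup>2 * (?w i)\<^sup>2)"
      unfolding T_def Q_def using Q knot_weight_pos by (intro weighted_hyperplane_bound) (auto simp: Q_def)
    ultimately show ?thesis
      using d by (simp add: T_diff)
  qed
  obtain v where v: "T v = - T c" "sqrt (\<Sum>i=1..n. (v i)\<^sup>2 * (?w i)\<^sup>2) = \<bar>- T c\<bar> / sqrt Q"
    using weighted_hyperplane_attained[of "{1..n}" ?w annihilator_ext "- T c"] Q knot_weight_pos
    unfolding T_def Q_def by blast
  define g where "g = bspline_comb p n \<xi> (\<lambda>i. c i + v i)"
  have g: "g \<in> reduced_space p n \<xi> r"
    unfolding mem_reduced_space_iff T[symmetric] g_def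
    by (rule exI[of _ "\<lambda>i. c i + v i"]) (simp add: T_add v)
  have "?dist g = sqrt (\<Sum>i=1..n. (v i)\<^sup>2 * (?w i)\<^sup>2)"
    using s by (intro knot_norm_eq) (simp add: g_def bspline_comb_add)
  then have dist_g: "?dist g = \<bar>T c\<bar> / sqrt Q"
    using v by simp
  show "\<exists>g. is_arg_min ?dist (\<lambda>g. g \<in> reduced_space p n \<xi> r) g"
    using g lower dist_g by (auto simp: is_arg_min_def not_less intro!: exI[of _ g])
  have "removal_error p n \<xi> r s = ?dist g"
    unfolding removal_error_def
  proof (rule Least_equality)
    show "?dist g \<in> ?dist ` reduced_space p n \<xi> r"
      using g by (rule imageI)
  qed (use lower dist_g in auto)
  also have "\<dots> = 1 / sqrt Q * \<bar>T c\<bar>"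
    unfolding dist_g by simp
  finally show "removal_error p n \<xi> r s =
      gamma_loc p l \<xi> r * loc_weight p \<xi> r width * \<bar>\<Sum>j=1..width. annihilator j * c (off + j)\<bar>"
    unfolding Q T .
qed

end

section \<open>Splines as piecewise polynomials\<close>

lemma higher_pderiv_diff: "(pderiv ^^ k) (f - g :: real poly) = (pderiv ^^ k) f - (pderiv ^^ k) g"
  using higher_pderiv_add[of k f "- g"] higher_pderiv_smult[of k "- 1" g] by simp

text \<open>With base point \<open>t\<close>, the zero of \<open>f\<close> of order \<open>l\<close>
  kills the terms with \<open>v > p - l\<close>, and the hypothesis on \<open>h\<close> kills those
  with \<open>v < p - l\<close>.\<close>

lemma pairing_vanishing:
  assumes "l \<le> p" "f = [:- t, 1:] ^ l * R" "degree f \<le> p" "degree h \<le> p"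
    and h: "\<And>k. k < p - l \<Longrightarrow> poly ((pderiv ^^ k) h) t = 0"
  shows "pairing p f h u =
    (- 1) ^ (p - l) * (fact l / fact p) * poly R t * poly ((pderiv ^^ (p - l)) h) t"
proof -
  have "(- 1) ^ v * poly ((pderiv ^^ (p - v)) f) t * poly ((pderiv ^^ v) h) t =
      (if v = p - l then (- 1) ^ (p - l) * fact l * poly R t * poly ((pderiv ^^ (p - l)) h) t else 0)"
    if "v \<le> p" for v
  proof (cases "v < p - l")
    case False
    then have "p - v \<le> l"
      using assms(1) that by auto
    then show ?thesis
      using poly_higher_pderiv_linear_power_mult[of "p - v" l t R] assms(1) that
      unfolding assms(2) by auto
  qed (use h in auto)
  then have "pairing p f h t = (\<Sum>v\<le>p. if v = p - l
      then (- 1) ^ (p - l) * fact l * poly R t * poly ((pderiv ^^ (p - l)) h) t else 0) / fact p"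
    unfolding pairing_def by (intro arg_cong2[of _ _ _ _ "(/)"] sum.cong) auto
  then show ?thesis
    using pairing_base_point[OF assms(3,4), of u t] by simp
qed

lemma dual_poly_factor:
  assumes "i \<le> u" "v \<le> i + p" "\<And>k. k \<in> {u + 1..v} \<Longrightarrow> \<xi> k = t"
  shows "dual_poly \<xi> p i = [:- t, 1:] ^ (v - u) * (\<Prod>k\<in>{i + 1..i + p} - {u + 1..v}. [:- \<xi> k, 1:])"
proof -
  have "dual_poly \<xi> p i = (\<Prod>k\<in>{i + 1..i + p} - {u + 1..v}. [:- \<xi> k, 1:]) * (\<Prod>k\<in>{u + 1..v}. [:- \<xi> k, 1:])"
    unfolding dual_poly_def using assms(1,2) by (intro prod.subset_diff) auto
  also have "(\<Prod>k\<in>{u + 1..v}. [:- \<xi> k, 1:]) = (\<Prod>k\<in>{u + 1..v}. [:- t, 1:])"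
    using assms(3) by (intro prod.cong) auto
  also have "\<dots> = [:- t, 1:] ^ (v - u)"
    by simp
  finally show ?thesis
    by (simp only: mult.commute)
qed

lemma higher_deriv_eq_poly:
  assumes "open U" "\<And>x. x \<in> U \<Longrightarrow> s x = poly q x" "x \<in> U"
  shows "(deriv ^^ k) s x = poly ((pderiv ^^ k) q) x"
  using assms(3)
proof (induction k arbitrary: x)
  case (Suc k)
  have "eventually (\<lambda>y. (deriv ^^ k) s y = poly ((pderiv ^^ k) q) y) (nhds x)"
    using Suc assms(1) by (auto simp: eventually_nhds)
  then have "deriv ((deriv ^^ k) s) x = deriv (poly ((pderiv ^^ k) q)) x"
    by (rule deriv_cong_ev) simp
  also have "\<dots> = poly (pderiv ((pderiv ^^ k) q)) x"
    by (rule DERIV_imp_deriv) (rule poly_DERIV)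
  finally show ?case
    by simp
qed (use assms(2) in simp)

section \<open>Positions of the breakpoints in the knot vector\<close>

lemma nth_concat_replicate:
  assumes "a \<le> j" "j < b" "q < m j"
  shows "concat (map (\<lambda>j. replicate (m j) (z j)) [a..<b]) ! ((\<Sum>i\<in>{a..<j}. m i) + q) = z j"
proof -
  have "[a..<b] = [a..<j] @ j # [Suc j..<b]"
    using assms upt_add_eq_append[of a j "b - j"] upt_conv_Cons[of j b] by simp
  moreover have "length (concat (map (\<lambda>j. replicate (m j) (z j)) [a..<j])) = (\<Sum>i\<in>{a..<j}. m i)"
    by (simp add: length_concat comp_def interv_sum_list_conv_sum_set_nat)
  ultimately show ?thesis
    using assms by (simp add: nth_append)
qed

locale spline_setting =
  fixes p N :: nat and \<zeta> \<xi> :: "nat \<Rightarrow> real" and m :: "nat \<Rightarrow> nat"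
  assumes p_pos: "1 \<le> p"
    and breakpoints: "breakpoint_data p N \<zeta> m"
    and knots: "basic_knot_vector p N \<zeta> m \<xi>"
begin

abbreviation "n \<equiv> spline_dim p N m"

text \<open>For \<open>1 \<le> j < N\<close>, the position of the last copy of breakpoint
  \<open>j\<close>. Piece \<open>j\<close> is therefore the knot interval with this index.\<close>

definition last_index :: "nat \<Rightarrow> nat" where
  "last_index j = p + 1 + (\<Sum>i\<in>{2..<Suc j}. m i)"

lemma N_ge: "2 \<le> N" and mult: "j \<in> {2..<N} \<Longrightarrow> 1 \<le> m j \<and> m j \<le> p + 1"
  using breakpoints by (auto simp: breakpoint_data_def)

lemma \<zeta>_less: "1 \<le> i \<Longrightarrow> i < j \<Longrightarrow> j \<le> N \<Longrightarrow> \<zeta> i < \<zeta> j"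
  using breakpoints by (auto simp: breakpoint_data_def strict_mono_on_def)

lemma last_index_1: "last_index (Suc 0) = p + 1"
  by (simp add: last_index_def)

lemma last_index_N: "last_index (N - 1) = n"
  using N_ge by (simp add: last_index_def spline_dim_def)

lemma last_index_Suc: "1 \<le> j \<Longrightarrow> last_index (Suc j) = last_index j + m (Suc j)"
  by (simp add: last_index_def)

lemma last_index_mono: "i \<le> j \<Longrightarrow> last_index i \<le> last_index j"
  unfolding last_index_def by (intro add_left_mono sum_mono2) auto

lemma last_index_range: "1 \<le> j \<Longrightarrow> j < N \<Longrightarrow> last_index j \<in> {p + 1..n}"
  using last_index_mono[of 1 j] last_index_mono[of j "N - 1"] last_index_1 last_index_N by auto

lemma \<xi>_interior:
  assumes "2 \<le> j" "j < N" "last_index (j - 1) < k" "k \<le> last_index j"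
  shows "\<xi> k = \<zeta> j"
proof -
  define q where "q = k - (last_index (j - 1) + 1)"
  define P where "P = (\<Sum>i\<in>{2..<j}. m i)"
  have P: "last_index (j - 1) = p + 1 + P"
    using assms(1) by (simp add: last_index_def P_def)
  have "last_index j = last_index (j - 1) + m j"
    using last_index_Suc[of "j - 1"] assms(1) by simp
  then have k: "k = p + 2 + (P + q)" and q: "q < m j"
    using assms P by (auto simp: q_def)
  have kn: "k < n + 1"
    using assms last_index_range[of j] by auto
  have "\<xi> k = map \<xi> [p + 2..<n + 1] ! (P + q)"
    using k kn by (subst nth_map) (auto simp: less_diff_conv simp del: upt_Suc)
  also have "\<dots> = concat (map (\<lambda>j. replicate (m j) (\<zeta> j)) [2..<N]) ! (P + q)"
    using knots by (simp add: basic_knot_vector_def Let_def)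
  also have "\<dots> = \<zeta> j"
    unfolding P_def using assms q by (intro nth_concat_replicate)
  finally show ?thesis .
qed

lemma \<xi>_last_index:
  assumes "1 \<le> j" "j < N"
  shows "\<xi> (last_index j) = \<zeta> j" "\<xi> (last_index j + 1) = \<zeta> (j + 1)"
proof -
  show "\<xi> (last_index j) = \<zeta> j"
  proof (cases "j = 1")
    case True
    then show ?thesis
      using knots by (simp add: basic_knot_vector_def Let_def last_index_1)
  next
    case False
    then have "last_index j = last_index (j - 1) + m j"
      using last_index_Suc[of "j - 1"] assms by simp
    then show ?thesis
      using mult[of j] assms False by (intro \<xi>_interior) auto
  qed
  show "\<xi> (last_index j + 1) = \<zeta> (j + 1)"
  proof (cases "j + 1 = N")
    case True
    then have "j = N - 1"
      by simp
    then show ?thesis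
      using knots True last_index_N by (simp add: basic_knot_vector_def Let_def)
  next
    case False
    then show ?thesis
      using mult[of "j + 1"] assms last_index_Suc[of j] by (intro \<xi>_interior) auto
  qed
qed

lemma ends_eq: "\<xi> (p + 1) = \<zeta> 1" "\<xi> (n + 1) = \<zeta> N"
  using knots by (simp_all add: basic_knot_vector_def Let_def)

text \<open>\<open>J\<close> is the first piece met by the support of B-spline \<open>i\<close>. The
  upper bound holds because \<open>i\<close> exceeds \<open>last_index (J - 1)\<close> and a
  multiplicity is at most \<open>p + 1\<close>; for \<open>J = 1\<close> it is immediate.\<close>

lemma ex_active:
  assumes "i \<in> {1..n}"
  defines "J \<equiv> LEAST j. 1 \<le> j \<and> i \<le> last_index j"
  shows "1 \<le> J" "J < N" "i \<le> last_index J" "last_index J \<le> i + p"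
    and "\<And>j. 1 \<le> j \<Longrightarrow> i \<le> last_index j \<Longrightarrow> J \<le> j"
proof -
  have ex: "1 \<le> N - 1 \<and> i \<le> last_index (N - 1)"
    using assms N_ge last_index_N by simp
  show J: "1 \<le> J" "i \<le> last_index J"
    using LeastI[of "\<lambda>j. 1 \<le> j \<and> i \<le> last_index j", OF ex] by (auto simp: J_def)
  show least: "J \<le> j" if "1 \<le> j" "i \<le> last_index j" for j
    unfolding J_def using that by (intro Least_le) simp
  show "J < N"
    using least[of "N - 1"] ex N_ge by simp
  show "last_index J \<le> i + p"
  proof (cases "J = 1")
    case True
    then show ?thesis
      using assms(1) by (simp add: last_index_1)
  next
    case False
    then have "\<not> i \<le> last_index (J - 1)"
      using least[of "J - 1"] J by force
    moreover have "last_index J = last_index (J - 1) + m J"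
      using last_index_Suc[of "J - 1"] J False by simp
    ultimately show ?thesis
      using mult[of J] \<open>J < N\<close> J False by auto
  qed
qed

sublocale kv: basic_knot_vector_supported p n \<xi>
proof
  show "mono_on {1..n + p + 1} \<xi>"
    using knots by (simp add: basic_knot_vector_def Let_def)
  show "\<xi> (p + 1) < \<xi> (n + 1)"
    using \<zeta>_less[of 1 N] N_ge by (simp add: ends_eq[simplified])
  fix i
  assume i: "i \<in> {1..n}"
  define J where "J = (LEAST j. 1 \<le> j \<and> i \<le> last_index j)"
  note J = ex_active[OF i, folded J_def]
  show "\<exists>\<mu>\<in>{p + 1..n}. i \<le> \<mu> \<and> \<mu> \<le> i + p \<and> \<xi> \<mu> < \<xi> (\<mu> + 1)"
    using J last_index_range[of J] \<xi>_last_index[of J] \<zeta>_less[of J "J + 1"]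
    by (intro bexI[of _ "last_index J"]) auto
qed

lemma knot_interval_eq_piece:
  assumes "1 \<le> j" "j < N"
  shows "knot_interval (\<xi> (n + 1)) \<xi> (last_index j) = piece N \<zeta> j"
  using \<zeta>_less[of "j + 1" N] assms
  by (auto simp: knot_interval_def piece_def \<xi>_last_index[OF assms, simplified] ends_eq[simplified])

text \<open>An index that is not the last of its block has a successor in the same block, so its
  interval is degenerate.\<close>

lemma nontrivial_knot_interval:
  assumes "\<mu> \<in> {p + 1..n}" "\<xi> \<mu> < \<xi> (\<mu> + 1)"
  obtains j where "1 \<le> j" "j < N" "\<mu> = last_index j"
proof -
  define J where "J = (LEAST j. 1 \<le> j \<and> \<mu> \<le> last_index j)"
  have \<mu>: "\<mu> \<in> {1..n}"
    using assms by auto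
  note J = ex_active[OF \<mu>, folded J_def]
  have "\<mu> = last_index J"
  proof (rule ccontr)
    assume ne: "\<mu> \<noteq> last_index J"
    have "J \<noteq> 1"
      using assms(1) J(3) ne by (auto simp: last_index_1)
    moreover have "\<not> \<mu> \<le> last_index (J - 1)"
      using J(1) J(5)[of "J - 1"] \<open>J \<noteq> 1\<close> by force
    ultimately have "\<xi> \<mu> = \<zeta> J" "\<xi> (\<mu> + 1) = \<zeta> J"
      using J ne by (auto intro!: \<xi>_interior)
    then show False
      using assms(2) by simp
  qed
  then show thesis
    using that J by blast
qed

text \<open>Translates the description of the removed knot by value, position and cardinality into
  block indices.\<close>

lemma multiplicity:
  assumes "2 \<le> j" "j < N" "\<xi> i = \<zeta> j" "i \<in> {1..n + p}" "\<xi> i < \<xi> (i + 1)"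
  shows "i = last_index j" "card {k \<in> {1..n + p + 1}. \<xi> k = \<xi> i} = m j"
proof -
  have Suc: "last_index j = last_index (j - 1) + m j"
    using last_index_Suc[of "j - 1"] assms by simp
  have "\<xi> k = \<zeta> j \<longleftrightarrow> k \<in> {last_index (j - 1) + 1..last_index j}" if "k \<in> {1..n + p + 1}" for k
  proof -
    consider "k \<le> last_index (j - 1)" | "k \<in> {last_index (j - 1) + 1..last_index j}" | "last_index j + 1 \<le> k"
      by force
    then show ?thesis
    proof cases
      case 1
      then have "\<xi> k \<le> \<xi> (last_index (j - 1))"
        using that last_index_range[of "j - 1"] assms by (intro kv.knots_le) fastforce+
      also have "\<dots> < \<zeta> j"
        using \<xi>_last_index(1)[of "j - 1"] \<zeta>_less[of "j - 1" j] assms by simp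
      finally show ?thesis
        using 1 by simp
    next
      case 2
      then show ?thesis
        using \<xi>_interior[of j k] assms by auto
    next
      case 3
      have "\<zeta> j < \<xi> (last_index j + 1)"
        using \<xi>_last_index(2)[of j] \<zeta>_less[of j "j + 1"] assms by simp
      also have "\<dots> \<le> \<xi> k"
        using 3 that by (intro kv.knots_le) auto
      finally show ?thesis
        using 3 by simp
    qed
  qed
  note eq = this
  have "{k \<in> {1..n + p + 1}. \<xi> k = \<xi> i} = {last_index (j - 1) + 1..last_index j}"
    unfolding assms(3) using eq last_index_range[of j] assms(1,2) by auto
  then show "card {k \<in> {1..n + p + 1}. \<xi> k = \<xi> i} = m j"
    using Suc by simp
  show "i = last_index j"
    using eq[of i] eq[of "i + 1"] assms by force
qed

lemma piecewise_poly:
  assumes "s \<in> spline_space p N \<zeta> m"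
  obtains q where "\<And>j. 1 \<le> j \<Longrightarrow> j < N \<Longrightarrow> degree (q j) \<le> p"
    and "\<And>j x. 1 \<le> j \<Longrightarrow> j < N \<Longrightarrow> x \<in> piece N \<zeta> j \<Longrightarrow> s x = poly (q j) x"
proof -
  have "\<forall>j\<in>{1..<N}. \<exists>q. degree q \<le> p \<and> (\<forall>x\<in>piece N \<zeta> j. s x = poly q x)"
    using assms by (auto simp: spline_space_def)
  from bchoice[OF this] obtain q where
    "\<forall>j\<in>{1..<N}. degree (q j) \<le> p \<and> (\<forall>x\<in>piece N \<zeta> j. s x = poly (q j) x)"
    by blast
  then show thesis
    by (intro that[of q]) auto
qed

lemma knot_removal_supported_last_index:
  assumes "2 \<le> j" "j < N" "m j = Suc l"
  shows "knot_removal_supported p n \<xi> (last_index j) l"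
proof -
  have r: "last_index j = last_index (j - 1) + Suc l"
    using last_index_Suc[of "j - 1"] assms by simp
  have prev: "last_index (j - 1) \<in> {p + 1..n}"
    using assms by (intro last_index_range) auto
  have supp: "\<xi> i < \<xi> (i + p + 1)" if i: "i \<in> {1..n}" for i
  proof -
    obtain \<mu> where \<mu>: "\<mu> \<in> {p + 1..n}" "i \<le> \<mu>" "\<mu> \<le> i + p" "\<xi> \<mu> < \<xi> (\<mu> + 1)"
      using kv.support[OF i] by blast
    have "\<xi> i \<le> \<xi> \<mu>" "\<xi> (\<mu> + 1) \<le> \<xi> (i + p + 1)"
      using \<mu> i by (auto intro!: kv.knots_le)
    then show ?thesis
      using \<mu>(4) by linarith
  qed
  show ?thesis
  proof unfold_locales
    show "p + 2 \<le> last_index j" "last_index j \<le> n"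
      using r prev last_index_range[of j] assms by auto
    show "\<xi> (last_index j) < \<xi> (last_index j + 1)"
      using \<xi>_last_index[of j] \<zeta>_less[of j "j + 1"] assms by simp
    show "l \<le> p"
      using mult[of j] assms by auto
    show "\<xi> k = \<xi> (last_index j)" if "k \<in> {last_index j - l..last_index j}" for k
    proof -
      have "last_index (j - 1) < k" "k \<le> last_index j"
        using that r by auto
      then show ?thesis
        using \<xi>_interior[of j k] \<xi>_last_index(1)[of j] assms by simp
    qed
    have "last_index j - l - 1 = last_index (j - 1)"
      using r by simp
    then show "\<xi> (last_index j - l - 1) < \<xi> (last_index j)"
      using \<xi>_last_index(1)[of j] \<xi>_last_index(1)[of "j - 1"] \<zeta>_less[of "j - 1" j] assms by simp
  qed (use p_pos supp in auto)
qed

section \<open>B-spline coefficients of a spline with given polynomial pieces\<close>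

context
  fixes s :: "real \<Rightarrow> real" and q :: "nat \<Rightarrow> real poly"
  assumes s: "s \<in> spline_space p N \<zeta> m"
    and degree_q: "\<And>j. 1 \<le> j \<Longrightarrow> j < N \<Longrightarrow> degree (q j) \<le> p"
    and q: "\<And>j x. 1 \<le> j \<Longrightarrow> j < N \<Longrightarrow> x \<in> piece N \<zeta> j \<Longrightarrow> s x = poly (q j) x"
begin

lemma higher_deriv_piece:
  assumes "1 \<le> j" "j < N" "x \<in> {\<zeta> j<..<\<zeta> (j + 1)}"
  shows "(deriv ^^ k) s x = poly ((pderiv ^^ k) (q j)) x"
proof (rule higher_deriv_eq_poly)
  show "s y = poly (q j) y" if "y \<in> {\<zeta> j<..<\<zeta> (j + 1)}" for y
    using that assms(1,2) by (intro q) (auto simp: piece_def)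
qed (use assms in auto)

lemma higher_deriv_at_right:
  assumes "1 \<le> j" "j < N"
  shows "((deriv ^^ k) s \<longlongrightarrow> poly ((pderiv ^^ k) (q j)) (\<zeta> j)) (at_right (\<zeta> j))"
proof (rule Lim_transform_eventually)
  show "(poly ((pderiv ^^ k) (q j)) \<longlongrightarrow> poly ((pderiv ^^ k) (q j)) (\<zeta> j)) (at_right (\<zeta> j))"
    by (intro tendsto_intros)
  show "eventually (\<lambda>x. poly ((pderiv ^^ k) (q j)) x = (deriv ^^ k) s x) (at_right (\<zeta> j))"
    using eventually_at_right_real[of "\<zeta> j" "\<zeta> (j + 1)"] \<zeta>_less[of j "j + 1"] assms
    by (auto elim!: eventually_mono simp: higher_deriv_piece)
qed

lemma higher_deriv_at_left:
  assumes "2 \<le> j" "j \<le> N"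
  shows "((deriv ^^ k) s \<longlongrightarrow> poly ((pderiv ^^ k) (q (j - 1))) (\<zeta> j)) (at_left (\<zeta> j))"
proof (rule Lim_transform_eventually)
  show "(poly ((pderiv ^^ k) (q (j - 1))) \<longlongrightarrow> poly ((pderiv ^^ k) (q (j - 1))) (\<zeta> j)) (at_left (\<zeta> j))"
    by (intro tendsto_intros)
  have "eventually (\<lambda>x. x \<in> {\<zeta> (j - 1)<..<\<zeta> j}) (at_left (\<zeta> j))"
    using \<zeta>_less[of "j - 1" j] assms by (intro eventually_at_left_real) auto
  then show "eventually (\<lambda>x. poly ((pderiv ^^ k) (q (j - 1))) x = (deriv ^^ k) s x) (at_left (\<zeta> j))"
    using higher_deriv_piece[of "j - 1"] assms by (auto elim!: eventually_mono)
qed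

lemma jump_higher_deriv:
  assumes "2 \<le> j" "j < N"
  shows "jump ((deriv ^^ k) s) (\<zeta> j) = poly ((pderiv ^^ k) (q j - q (j - 1))) (\<zeta> j)"
proof -
  have "Lim (at_right (\<zeta> j)) ((deriv ^^ k) s) = poly ((pderiv ^^ k) (q j)) (\<zeta> j)"
    using assms by (intro tendsto_Lim higher_deriv_at_right) auto
  moreover have "Lim (at_left (\<zeta> j)) ((deriv ^^ k) s) = poly ((pderiv ^^ k) (q (j - 1))) (\<zeta> j)"
    using assms by (intro tendsto_Lim higher_deriv_at_left) auto
  ultimately show ?thesis
    by (simp add: jump_def higher_pderiv_diff)
qed

lemma smooth_higher_pderiv:
  assumes "2 \<le> j" "j < N" "k + m j \<le> p"
  shows "poly ((pderiv ^^ k) (q j - q (j - 1))) (\<zeta> j) = 0"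
proof -
  have "isCont ((deriv ^^ k) s) (\<zeta> j)"
    using s assms by (auto simp: spline_space_def)
  then have "((deriv ^^ k) s \<longlongrightarrow> (deriv ^^ k) s (\<zeta> j)) (at_right (\<zeta> j))"
    "((deriv ^^ k) s \<longlongrightarrow> (deriv ^^ k) s (\<zeta> j)) (at_left (\<zeta> j))"
    by (auto simp: isCont_def filterlim_at_split)
  then have "Lim (at_right (\<zeta> j)) ((deriv ^^ k) s) = (deriv ^^ k) s (\<zeta> j)"
    "Lim (at_left (\<zeta> j)) ((deriv ^^ k) s) = (deriv ^^ k) s (\<zeta> j)"
    by (intro tendsto_Lim; simp)+
  then have "jump ((deriv ^^ k) s) (\<zeta> j) = 0"
    by (simp add: jump_def)
  then show ?thesis
    unfolding jump_higher_deriv[OF assms(1,2)] .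
qed

lemma degree_jump:
  assumes "2 \<le> j" "j < N"
  shows "degree (q j - q (j - 1)) \<le> p"
  using assms degree_q[of j] degree_q[of "j - 1"] by (intro degree_diff_le) auto

text \<open>The de Boor--Fix functional on the first piece in the support;
  \<open>coeff_at_eq\<close> climbs from there to the later ones.\<close>

definition coeff_at :: "nat \<Rightarrow> real" where
  "coeff_at i = pairing p (dual_poly \<xi> p i) (q (LEAST j. 1 \<le> j \<and> i \<le> last_index j)) 0"

text \<open>
  Two neighbouring pieces give the same coefficient as long as the support of the B-spline
  contains both: the dual polynomial then vanishes to order \<open>m j\<close> at \<open>\<zeta> j\<close>, which complements
  the order of smoothness.
\<close>

lemma coeff_at_eq:
  assumes i: "i \<in> {1..n}" and "j < N" "1 \<le> j" "i \<le> last_index j" "last_index j \<le> i + p"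
  shows "coeff_at i = pairing p (dual_poly \<xi> p i) (q j) 0"
proof -
  define J where "J = (LEAST j. 1 \<le> j \<and> i \<le> last_index j)"
  note J = ex_active[OF i, folded J_def]
  have "J \<le> j"
    using J(5) assms by blast
  then show ?thesis
    using assms(2,5)
  proof (induction rule: dec_induct)
    case base
    then show ?case
      by (simp add: coeff_at_def J_def)
  next
    case (step j)
    have j: "2 \<le> Suc j" "Suc j < N" "1 \<le> j" "j < N"
      using step J by auto
    have IH: "coeff_at i = pairing p (dual_poly \<xi> p i) (q j) 0"
      using step last_index_mono[of j "Suc j"] by simp
    have "i \<le> last_index j"
      using J(3) last_index_mono[OF step(1)] by simp
    define l where "l = m (Suc j) - 1"
    define R where "R = (\<Prod>k\<in>{i + 1..i + p} - {last_index j + 1..last_index (Suc j)}. [:- \<xi> k, 1:])"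
    have m: "m (Suc j) = Suc l" "l \<le> p"
      using mult[of "Suc j"] j by (auto simp: l_def)
    have "dual_poly \<xi> p i = [:- \<zeta> (Suc j), 1:] ^ (last_index (Suc j) - last_index j) * R"
      unfolding R_def using j step \<open>i \<le> last_index j\<close>
      by (intro dual_poly_factor) (auto intro!: \<xi>_interior)
    also have "last_index (Suc j) - last_index j = Suc l"
      using last_index_Suc[of j] j m by simp
    \<comment> \<open>One factor of the zero of order \<open>l + 1\<close> is held back: it kills
      the surviving term of \<open>pairing_vanishing\<close>, which contains the possibly nonzero
      jump.\<close>
    finally have f: "dual_poly \<xi> p i = [:- \<zeta> (Suc j), 1:] ^ l * ([:- \<zeta> (Suc j), 1:] * R)"
      by (simp only: power_Suc2 mult.assoc)
    have "pairing p (dual_poly \<xi> p i) (q (Suc j) - q (Suc j - 1)) 0 = 0"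
      by (subst pairing_vanishing[OF m(2) f])
         (use j m smooth_higher_pderiv[of "Suc j"] degree_jump[of "Suc j"] in \<open>auto simp: degree_dual_poly\<close>)
    moreover have "q (Suc j) = (q (Suc j) - q (Suc j - 1)) + q j"
      by simp
    ultimately show ?case
      using IH pairing_add_right[of p "dual_poly \<xi> p i" "q (Suc j) - q (Suc j - 1)" "q j" 0] by simp
  qed
qed

text \<open>\<open>reproduction\<close> on each piece expands \<open>s\<close> with that piece's
  pairings, and by \<open>coeff_at_eq\<close> these do not depend on the piece.\<close>

lemma spline_eq_bspline_comb:
  assumes "x \<in> {\<xi> (p + 1)..\<xi> (n + 1)}"
  shows "s x = bspline_comb p n \<xi> coeff_at x"
proof -
  obtain \<mu> where \<mu>: "\<mu> \<in> {p + 1..n}" "\<xi> \<mu> < \<xi> (\<mu> + 1)" "x \<in> knot_interval (\<xi> (n + 1)) \<xi> \<mu>"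
    using kv.ex_knot_interval[OF assms] .
  obtain j where j: "1 \<le> j" "j < N" "\<mu> = last_index j"
    using nontrivial_knot_interval[OF \<mu>(1,2)] .
  interpret knot_piece p \<mu> \<xi>
    using \<mu> by (intro kv.knot_piece)
  have "s x = poly (q j) x"
    using \<mu>(3) j by (intro q) (simp_all add: knot_interval_eq_piece del: One_nat_def)
  also have "\<dots> = (\<Sum>i=\<mu> - p..\<mu>. pairing p (dual_poly \<xi> p i) (q j) 0 * poly (bspline_poly \<xi> \<mu> p i) x)"
    using j degree_q by (intro reproduction) auto
  also have "\<dots> = (\<Sum>i=\<mu> - p..\<mu>. coeff_at i * poly (bspline_poly \<xi> \<mu> p i) x)"
    using j \<mu>(1) by (intro sum.cong refl arg_cong2[of _ _ _ _ "(*)"] coeff_at_eq[symmetric]) auto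
  also have "\<dots> = bspline_comb p n \<xi> coeff_at x"
    unfolding kv.bspline_comb_eq_poly[OF \<mu>] by (simp add: poly_sum)
  finally show ?thesis .
qed

lemma spline_removal_error:
  assumes j: "2 \<le> j" "j < N" and m: "m j = Suc l"
  defines "r \<equiv> last_index j"
  shows "\<exists>g. is_arg_min (\<lambda>g. knot_norm p n \<xi> (\<lambda>x. g x - s x)) (\<lambda>g. g \<in> reduced_space p n \<xi> r) g"
    and "removal_error p n \<xi> r s = C_loc p l \<xi> r * \<bar>jump ((deriv ^^ (p - l)) s) (\<zeta> j)\<bar>"
    and "0 < C_loc p l \<xi> r"
proof -
  interpret R: knot_removal_supported p n \<xi> r l
    unfolding r_def using j m by (rule knot_removal_supported_last_index)
  let ?\<psi> = "\<lambda>i. dual_poly \<xi> p i"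
  let ?h = "q j - q (j - 1)"
  let ?prod = "\<Prod>k=r + 1..r + p - l. \<xi> k - \<xi> r"
  define i where "i = R.off + R.width"
  have i: "i = r - l" "i \<in> {1..n}"
    using R.r_ge R.r_le R.l_le by (auto simp: i_def)
  have r: "r = last_index (j - 1) + Suc l"
    using last_index_Suc[of "j - 1"] j m by (simp add: r_def)
  have t: "\<xi> r = \<zeta> j"
    using \<xi>_last_index(1)[of j] j by (simp add: r_def)
  \<comment> \<open>These B-splines have index at most \<open>last_index (j - 1)\<close>, so piece
    \<open>j - 1\<close> is in their support.\<close>
  have left: "coeff_at (R.off + k) = pairing p (?\<psi> (R.off + k)) (q (j - 1)) 0"
    if "k \<in> {1..p + 1 - l}" for k
    using that j r R.r_ge R.r_le R.l_le by (intro coeff_at_eq) auto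
  \<comment> \<open>The last B-spline begins at the removed breakpoint, so its coefficient must be
    read from piece \<open>j\<close>; this brings in the difference of the pieces.\<close>
  have right: "coeff_at i = pairing p (?\<psi> i) ?h 0 + pairing p (?\<psi> i) (q (j - 1)) 0"
  proof -
    have "coeff_at i = pairing p (?\<psi> i) (q j) 0"
      using j i R.r_ge R.l_le by (intro coeff_at_eq) (auto simp: r_def)
    then show ?thesis
      using pairing_add_right[of p "?\<psi> i" ?h "q (j - 1)" 0] by simp
  qed
  have split: "sum F {1..R.width} = F R.width + sum F {1..p + 1 - l}" for F :: "nat \<Rightarrow> real"
  proof -
    have "{1..R.width} = insert R.width {1..p + 1 - l}"
      using R.l_le by auto
    moreover have "R.width \<notin> {1..p + 1 - l}"
      using R.l_le by auto
    ultimately show ?thesis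
      by (simp only: sum.insert[OF finite_atLeastAtMost] not_False_eq_True)
  qed
  have "(\<Sum>k=1..R.width. R.annihilator k * coeff_at (R.off + k)) =
      coeff_at i + (\<Sum>k=1..p + 1 - l. R.annihilator k * coeff_at (R.off + k))"
    unfolding split R.annihilator_width i_def by simp
  also have "(\<Sum>k=1..p + 1 - l. R.annihilator k * coeff_at (R.off + k)) =
      (\<Sum>k=1..p + 1 - l. R.annihilator k * pairing p (?\<psi> (R.off + k)) (q (j - 1)) 0)"
    using left by (intro sum.cong) auto
  also have "coeff_at i + \<dots> = pairing p (?\<psi> i) ?h 0 +
      (\<Sum>k=1..R.width. R.annihilator k * pairing p (?\<psi> (R.off + k)) (q (j - 1)) 0)"
    unfolding split R.annihilator_width right unfolding i_def by simp
  also have "\<dots> = pairing p (?\<psi> i) ?h 0"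
    by (simp only: R.annihilator_pairing add_0_right)
  finally have T: "(\<Sum>k=1..R.width. R.annihilator k * coeff_at (R.off + k)) = pairing p (?\<psi> i) ?h 0" .
  define P where "P = (\<Prod>k\<in>{i + 1..i + p} - {i + 1..r}. [:- \<xi> k, 1:])"
  have "?\<psi> i = [:- \<zeta> j, 1:] ^ (r - i) * P"
    unfolding P_def using i R.r_ge R.l_le R.r_mult t by (intro dual_poly_factor) auto
  also have "r - i = l"
    using i R.r_ge R.l_le by auto
  finally have \<psi>: "?\<psi> i = [:- \<zeta> j, 1:] ^ l * P" .
  have smooth: "poly ((pderiv ^^ k) ?h) (\<zeta> j) = 0" if "k < p - l" for k
    using j m that by (intro smooth_higher_pderiv) auto
  have "{i + 1..i + p} - {i + 1..r} = {r + 1..r + p - l}"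
    using i R.r_ge R.l_le by auto
  \<comment> \<open>There are \<open>p - l\<close> factors, so the sign of the pairing reverses each
    of them into \<open>\<xi> k - \<xi> r\<close>.\<close>
  then have "(- 1) ^ (p - l) * poly P (\<zeta> j) = (- 1) ^ card {r + 1..r + p - l} * (\<Prod>k=r + 1..r + p - l. \<xi> r - \<xi> k)"
    using R.l_le by (simp add: P_def poly_prod t)
  also have "\<dots> = ?prod"
    unfolding prod_constant[symmetric] prod.distrib[symmetric] by (intro prod.cong) auto
  finally have P: "(- 1) ^ (p - l) * poly P (\<zeta> j) = ?prod" .
  have "pairing p (?\<psi> i) ?h 0 =
      (- 1) ^ (p - l) * (fact l / fact p) * poly P (\<zeta> j) * poly ((pderiv ^^ (p - l)) ?h) (\<zeta> j)"
    using degree_jump[OF j] smooth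
    by (intro pairing_vanishing[OF R.l_le \<psi>]) (simp_all only: degree_dual_poly order.refl)
  also have "\<dots> = fact l / fact p * ((- 1) ^ (p - l) * poly P (\<zeta> j)) * jump ((deriv ^^ (p - l)) s) (\<zeta> j)"
    unfolding jump_higher_deriv[OF j] by simp
  finally have pairing: "pairing p (?\<psi> i) ?h 0 = fact l / fact p * ?prod * jump ((deriv ^^ (p - l)) s) (\<zeta> j)"
    unfolding P .
  have prod_pos: "0 < ?prod"
  proof (intro prod_pos)
    fix k
    assume "k \<in> {r + 1..r + p - l}"
    then have "\<xi> (r + 1) \<le> \<xi> k"
      using R.r_le by (intro kv.knots_le) auto
    then show "0 < \<xi> k - \<xi> r"
      using R.r_last by simp
  qed
  have factor_pos: "0 < (fact l / fact p :: real)"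
    by simp
  show "\<exists>g. is_arg_min (\<lambda>g. knot_norm p n \<xi> (\<lambda>x. g x - s x)) (\<lambda>g. g \<in> reduced_space p n \<xi> r) g"
    by (rule R.removal_error_eq(1)) (rule spline_eq_bspline_comb)
  have "removal_error p n \<xi> r s =
      gamma_loc p l \<xi> r * loc_weight p \<xi> r R.width * \<bar>\<Sum>k=1..R.width. R.annihilator k * coeff_at (R.off + k)\<bar>"
    by (rule R.removal_error_eq(2)) (rule spline_eq_bspline_comb)
  then show "removal_error p n \<xi> r s = C_loc p l \<xi> r * \<bar>jump ((deriv ^^ (p - l)) s) (\<zeta> j)\<bar>"
    unfolding T pairing C_loc_def abs_mult abs_of_pos[OF prod_pos] abs_of_pos[OF factor_pos]
    by (simp only: mult.assoc)
  have "0 < gamma_loc p l \<xi> r * loc_weight p \<xi> r R.width"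
    unfolding R.annihilator_norm(2)[symmetric]
    by (rule divide_pos_pos[OF zero_less_one real_sqrt_gt_zero[OF R.annihilator_norm(1)]])
  from mult_pos_pos[OF mult_pos_pos[OF this factor_pos] prod_pos] show "0 < C_loc p l \<xi> r"
    unfolding C_loc_def .
qed

end

end

text \<open>With indices counted from the first local knot, every knot read by the constant has
  offset at most \<open>2 * p + 2 - l\<close>, which is the last entry of
  \<open>local_knots\<close>.\<close>

lemma C_loc_local:
  assumes "l \<le> p" "p + 2 \<le> i" "p + 2 \<le> i'" "local_knots p l \<xi>' i' = local_knots p l \<xi> i"
  shows "C_loc p l \<xi>' i' = C_loc p l \<xi> i"
proof -
  define a where "a = i - (p + 1)"
  define a' where "a' = i' - (p + 1)"
  have i: "i = a + (p + 1)" "i' = a' + (p + 1)"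
    using assms by (auto simp: a_def a'_def)
  have knot: "\<xi>' (a' + k) = \<xi> (a + k)" if "k < 2 * p + 3 - l" for k
  proof -
    have "map \<xi>' [a'..<a' + (2 * p + 3 - l)] = map \<xi> [a..<a + (2 * p + 3 - l)]"
      using assms(1,4) unfolding local_knots_def i by (simp add: add.commute add.left_commute mult_2 eval_nat_numeral)
    from arg_cong[OF this, of "\<lambda>xs. xs ! k"] show ?thesis
      using that by simp
  qed
  have index: "i + j - (p + 2) = a + (j - 1)" "i + j - 1 = a + (p + j)"
    "i' + j - (p + 2) = a' + (j - 1)" "i' + j - 1 = a' + (p + j)" if "1 \<le> j" for j
    using that by (auto simp: i)
  have weight: "loc_weight p \<xi>' i' j = loc_weight p \<xi> i j" if "j \<in> {1..p + 2 - l}" for j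
  proof -
    have "\<xi>' (a' + (j - 1) + p + 1) = \<xi> (a + (j - 1) + p + 1)" "\<xi>' (a' + (j - 1)) = \<xi> (a + (j - 1))"
      using knot[of "j - 1"] knot[of "j - 1 + p + 1"] that assms(1) by (auto simp: add.assoc)
    then show ?thesis
      using that by (simp only: loc_weight_def knot_weight_def index atLeastAtMost_iff)
  qed
  have alpha: "alpha p \<xi>' i' j = alpha p \<xi> i j" if "j \<in> {1..p + 2 - l}" for j
  proof -
    have "\<xi>' (a' + (j - 1)) = \<xi> (a + (j - 1))" "\<xi>' (a' + (p + j)) = \<xi> (a + (p + j))" "\<xi>' i' = \<xi> i"
      using knot[of "j - 1"] knot[of "p + j"] knot[of "p + 1"] that assms(1) unfolding i by auto
    then show ?thesis
      using that by (simp only: alpha_def index atLeastAtMost_iff)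
  qed
  have mu: "mu p \<xi>' i' j = mu p \<xi> i j" if "j \<in> {1..p + 1 - l}" for j
  proof -
    have "j \<in> {1..p + 2 - l}" "j + 1 \<in> {1..p + 2 - l}"
      using that assms(1) by auto
    then show ?thesis
      by (simp only: mu_def alpha)
  qed
  have last: "p + 2 - l \<in> {1..p + 2 - l}"
    using assms(1) by auto
  have "(\<Sum>j=1..p + 1 - l. 1 / (loc_weight p \<xi>' i' j)\<^sup>2 * (\<Prod>k=j..p + 1 - l. (mu p \<xi>' i' k)\<^sup>2)) =
      (\<Sum>j=1..p + 1 - l. 1 / (loc_weight p \<xi> i j)\<^sup>2 * (\<Prod>k=j..p + 1 - l. (mu p \<xi> i k)\<^sup>2))"
    using assms(1) weight mu by (intro sum.cong refl arg_cong2[of _ _ _ _ "(*)"] prod.cong) auto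
  then have gamma: "gamma_loc p l \<xi>' i' = gamma_loc p l \<xi> i"
    unfolding gamma_loc_def weight[OF last] by simp
  have "(\<Prod>k=i' + 1..i' + p - l. \<xi>' k - \<xi>' i') = (\<Prod>k=i + 1..i + p - l. \<xi> k - \<xi> i)"
  proof (rule prod.reindex_bij_witness[of _ "\<lambda>k. a' + (k - a)" "\<lambda>k. a + (k - a')"])
    fix k
    assume k: "k \<in> {i' + 1..i' + p - l}"
    then have "\<xi>' (a' + (k - a')) = \<xi> (a + (k - a'))" "\<xi>' i' = \<xi> i"
      using knot[of "k - a'"] knot[of "p + 1"] assms(1) unfolding i by auto
    then show "\<xi> (a + (k - a')) - \<xi> i = \<xi>' k - \<xi>' i'"
      using k by (simp add: i)
  qed (auto simp: i)
  then show ?thesis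
    unfolding C_loc_def gamma weight[OF last] by simp
qed

theorem theorem3p10:
  fixes p N n i0 j0 l :: nat
    and \<zeta> \<xi> :: "nat \<Rightarrow> real" and m :: "nat \<Rightarrow> nat" and s :: "real \<Rightarrow> real"
  assumes "1 \<le> p"
    and "breakpoint_data p N \<zeta> m"
    and "n = spline_dim p N m"
    and "basic_knot_vector p N \<zeta> m \<xi>"
    and "2 \<le> j0" and "j0 \<le> N - 1"
    and "2 \<le> i0" and "i0 \<le> n + p"
    and "\<xi> i0 = \<zeta> j0"
    and "\<xi> (i0 - 1) \<le> \<xi> i0" and "\<xi> i0 < \<xi> (i0 + 1)"
    and "l + 1 = card {i \<in> {1..n + p + 1}. \<xi> i = \<xi> i0}"
    and "s \<in> spline_space p N \<zeta> m"
  shows "(\<exists>g. is_arg_min (\<lambda>g. knot_norm p n \<xi> (\<lambda>x. g x - s x)) (\<lambda>g. g \<in> reduced_space p n \<xi> i0) g) \<and>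
         removal_error p n \<xi> i0 s = C_loc p l \<xi> i0 * \<bar>jump ((deriv ^^ (p - l)) s) (\<zeta> j0)\<bar> \<and>
         0 < C_loc p l \<xi> i0 \<and>
         (\<forall>\<xi>' i0'. p + 2 \<le> i0' \<and> local_knots p l \<xi>' i0' = local_knots p l \<xi> i0 \<longrightarrow>
            C_loc p l \<xi>' i0' = C_loc p l \<xi> i0)"
proof -
  interpret spline_setting p N \<zeta> \<xi> m
    using assms(1,2,4) by unfold_locales
  have j0: "2 \<le> j0" "j0 < N"
    using assms(5,6) N_ge by auto
  \<comment> \<open>The strict increase after \<open>i0\<close> makes it the last copy of the
    breakpoint, and the cardinality identifies \<open>l + 1\<close> with the prescribed
    multiplicity.\<close>
  have i0: "i0 = last_index j0" "m j0 = Suc l"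
    using multiplicity[OF j0 assms(9)] assms(3,7,8,11,12) by auto
  obtain q where q: "\<And>j. 1 \<le> j \<Longrightarrow> j < N \<Longrightarrow> degree (q j) \<le> p"
    "\<And>j x. 1 \<le> j \<Longrightarrow> j < N \<Longrightarrow> x \<in> piece N \<zeta> j \<Longrightarrow> s x = poly (q j) x"
    by (rule piecewise_poly[OF assms(13)]) (rule that; blast)
  interpret R: knot_removal_supported p "spline_dim p N m" \<xi> i0 l
    unfolding i0(1) using j0 i0(2) by (rule knot_removal_supported_last_index)
  note error = spline_removal_error[of s q, OF assms(13) q j0 i0(2), folded i0(1)]
  show ?thesis
    unfolding assms(3) using error C_loc_local[OF R.l_le R.r_ge] by blast
qed

end
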